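(* Let $L/K$ be a finite totally ramified separable extension of degree $n=up^{\nu}$ with $p\nmid u$, where $K$ is complete with respect to a discrete valuation and has perfect residue field of characteristic $p$. Let $\pi_L$, $\tilde{\pi}_L$ be uniformizers for $L$, with minimum polynomials over $K$ \[f(X)=X^n-c_1X^{n-1}+\cdots+(-1)^{n-1}c_{n-1}X+(-1)^nc_n,\] \[\tilde{f}(X)=X^n-\tilde{c}_1X^{n-1}+\cdots+(-1)^{n-1}\tilde{c}_{n-1}X+(-1)^n\tilde{c}_n\] respectively. Suppose there are an integer $\ell\ge1$ and $\sigma\in\mathrm{Aut}_K(L)$ such that $\sigma(\tilde{\pi}_L)\equiv\pi_L\pmod{\mathcal{M}_L^{\ell+1}}$. Then for every $1\le h\le n$ we have \[\tilde{c}_h\equiv c_h\pmod{\mathcal{M}_K^{\rho_h(\ell)}},\qquad\text{where } \rho_h(\ell)=\left\lceil\frac{\phi_j(\ell)+h}{n}\right\rceil \text{ with } j=\overline{v}_p(h),\] and $\phi_j$ is the $j$th generalized Hasse-Herbrand function of $L/K$.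
   Context: $K$ is a field complete with respect to a discrete valuation $v_K$ (normalized so that a uniformizer of $K$ has valuation 1), with ring of integers $\mathcal{O}_K$ and maximal ideal $\mathcal{M}_K$; its residue field $\mathcal{O}_K/\mathcal{M}_K$ is perfect of characteristic $p$. $L/K$ is a finite totally ramified subextension of a separable closure of $K$, of degree $n=up^{\nu}$ with $p\nmid u$; $v_L$ is the normalized valuation of $L$, $\mathcal{M}_L$ the maximal ideal of its ring of integers, and $e_L=v_L(p)$ (so $e_L=\infty$ if $\mathrm{char}(K)=p$). $\mathrm{Aut}_K(L)$ is the group of $K$-automorphisms of $L$. For $k\in\mathbb{Z}$ set $\overline{v}_p(k)=\min\{v_p(k),\nu\}$, where $v_p$ is the $p$-adic valuation on integers. Indices of inseparability: let $\pi_L$ be a uniformizer for $L$ with minimum polynomial $X^n-c_1X^{n-1}+\cdots+(-1)^nc_n$ over $K$. For $0\le j\le\nu$ set \[i_j^{\pi_L}=\min\{nv_K(c_h)-h:1\le h\le n,\ \overline{v}_p(h)\le j\}\] (a nonnegative integer or $\infty$, with $v_K(0)=\infty$), and define the $j$th index of inseparability of $L/K$ to be \[i_j=\min\{i_{j'}^{\pi_L}+(j'-j)e_L:j\le j'\le\nu\},\] with the convention $0\cdot\infty=0$ (so $i_j=i_j^{\pi_L}$ if $\mathrm{char}(K)=p$). It is known that $i_j$ is finite and does not depend on the choice of $\pi_L$. Generalized Hasse-Herbrand functions: for $0\le j\le\nu$ and real $x\ge0$ set $\tilde{\phi}_j(x)=i_j+p^jx$ and \[\phi_j(x)=\min\{\tilde{\phi}_{j_0}(x):0\le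 j_0\le j\}.\] *)

theory Defs
  imports
    Complex_Main
    "HOL-Library.Extended_Real"
    "HOL-Algebra.QuotRing"
    "HOL-Algebra.Ideal_Product"
    "HOL-Algebra.Algebraic_Closure_Type"
    "Subresultants.More_Homomorphisms"
begin

section \<open>Discretely valued fields\<close>

text \<open>Valuations are normalized: the value group is exactly the integers, embedded in
  \<^typ>\<open>ereal\<close>, and \<open>v 0 = \<infinity>\<close>.\<close>

locale normalized_discrete_valuation =
  fixes v :: "'a::field \<Rightarrow> ereal"
  assumes v_eq_top_iff: "v x = \<infinity> \<longleftrightarrow> x = 0"
    and v_int: "x \<noteq> 0 \<Longrightarrow> \<exists>k::int. v x = ereal (of_int k)"
    and v_mult: "v (x * y) = v x + v y"
    and v_add: "min (v x) (v y) \<le> v (x + y)"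
    and v_uniformizer: "\<exists>x. v x = 1"

definition uniformizer :: "('a::field \<Rightarrow> ereal) \<Rightarrow> 'a \<Rightarrow> bool"
  where "uniformizer v x \<longleftrightarrow> v x = 1"

locale complete_discretely_valued_field = normalized_discrete_valuation v
  for v :: "'a::field \<Rightarrow> ereal" +
  assumes complete:
    "\<And>s :: nat \<Rightarrow> 'a.
     (\<And>N::nat. \<exists>M. \<forall>m\<ge>M. \<forall>k\<ge>M. ereal (real N) \<le> v (s m - s k)) \<Longrightarrow>
     \<exists>x. \<forall>N::nat. \<exists>M. \<forall>m\<ge>M. ereal (real N) \<le> v (s m - x)"

definition valuation_ring :: "('a::field \<Rightarrow> ereal) \<Rightarrow> 'a ring"
  where "valuation_ring v =
    \<lparr>carrier = {x. 0 \<le> v x}, monoid.mult = (*), one = 1, ring.zero = 0, add = (+)\<rparr>"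

definition max_ideal :: "('a::field \<Rightarrow> ereal) \<Rightarrow> 'a set"
  where "max_ideal v = {x. 0 < v x}"

text \<open>The \<open>r\<close>-th power is taken in the monoid of ideals of the valuation ring; the lemma
  \<open>max_ideal_power_eq\<close> below identifies it with \<open>{x. r \<le> v x}\<close>.\<close>

definition max_ideal_power :: "('a::field \<Rightarrow> ereal) \<Rightarrow> nat \<Rightarrow> 'a set"
  where "max_ideal_power v r = max_ideal v [^]\<^bsub>ideals_set (valuation_ring v)\<^esub> r"

definition cong_mod :: "'a::field \<Rightarrow> 'a \<Rightarrow> 'a set \<Rightarrow> bool"
  where "cong_mod x y I \<longleftrightarrow> x - y \<in> I"

definition residue_field :: "('a::field \<Rightarrow> ereal) \<Rightarrow> 'a set ring"
  where "residue_field v = valuation_ring v Quot max_ideal v"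

definition has_characteristic :: "('b, 'm) ring_scheme \<Rightarrow> nat \<Rightarrow> bool"
  where "has_characteristic F p \<longleftrightarrow> (\<forall>m::nat. [m] \<cdot>\<^bsub>F\<^esub> \<one>\<^bsub>F\<^esub> = \<zero>\<^bsub>F\<^esub> \<longleftrightarrow> p dvd m)"

text \<open>In characteristic \<open>p > 0\<close> a field is perfect iff its Frobenius endomorphism is surjective.\<close>

definition perfect_of_characteristic :: "('b, 'm) ring_scheme \<Rightarrow> nat \<Rightarrow> bool"
  where "perfect_of_characteristic F p \<longleftrightarrow> prime p \<and> has_characteristic F p \<and>
    (\<lambda>x. x [^]\<^bsub>F\<^esub> p) ` carrier F = carrier F"

lemma (in normalized_discrete_valuation) max_ideal_power_eq:
  "max_ideal_power v r = {x. ereal (real r) \<le> v x}"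
proof (induction r)
  case 0
  then show ?case
    by (simp add: max_ideal_power_def ideals_set_def valuation_ring_def nat_pow_def
        zero_ereal_def)
next
  case (Suc r)
  let ?O = "valuation_ring v"
  have rec: "max_ideal_power v (Suc r) = ideal_prod ?O (max_ideal_power v r) (max_ideal v)"
    by (simp add: max_ideal_power_def ideals_set_def nat_pow_def)
  show ?case
  proof (intro equalityI subsetI)
    fix x assume "x \<in> max_ideal_power v (Suc r)"
    then have "x \<in> ideal_prod ?O {x. ereal (real r) \<le> v x} (max_ideal v)"
      using rec Suc.IH by simp
    then have "ereal (real (Suc r)) \<le> v x"
    proof (induction rule: ideal_prod.induct)
      case (prod i j)
      have "1 \<le> v j"
      proof (cases "j = 0")
        case True
        then show ?thesis using v_eq_top_iff[of j] by simp
      next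
        case False
        then obtain k :: int where "v j = ereal (of_int k)" using v_int by blast
        with prod(2) show ?thesis
          by (simp add: max_ideal_def zero_ereal_def one_ereal_def)
      qed
      with prod(1) have "ereal (real r) + 1 \<le> v i + v j"
        by (intro add_mono) auto
      then show ?case
        by (simp add: valuation_ring_def v_mult one_ereal_def add.commute)
    next
      case (sum s1 s2)
      then have "ereal (real (Suc r)) \<le> min (v s1) (v s2)" by simp
      also have "\<dots> \<le> v (s1 + s2)" by (rule v_add)
      finally show ?case by (simp add: valuation_ring_def)
    qed
    then show "x \<in> {x. ereal (real (Suc r)) \<le> v x}" by simp
  next
    fix x assume "x \<in> {x. ereal (real (Suc r)) \<le> v x}"
    then have x: "ereal (real (Suc r)) \<le> v x" by simp
    obtain t where t: "v t = 1" using v_uniformizer by blast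
    have "t \<noteq> 0" using t v_eq_top_iff[of t] by (auto simp: one_ereal_def)
    then have eq: "x = (x / t) * t" by simp
    have "ereal (real (Suc r)) \<le> v (x / t) + 1"
      using x eq t v_mult[of "x / t" t] by simp
    then have "ereal (real r) \<le> v (x / t)"
      by (cases "v (x / t)") (auto simp: one_ereal_def)
    moreover have "t \<in> max_ideal v" using t by (simp add: max_ideal_def)
    ultimately have "(x / t) \<otimes>\<^bsub>?O\<^esub> t \<in> ideal_prod ?O (max_ideal_power v r) (max_ideal v)"
      using Suc.IH by (intro ideal_prod.prod) auto
    then show "x \<in> max_ideal_power v (Suc r)"
      using rec eq by (simp add: valuation_ring_def)
  qed
qed

section \<open>Field extensions\<close>

text \<open>An extension \<open>L/K\<close> is given by a field homomorphism \<open>\<iota>\<close> from \<open>K\<close> to \<open>L\<close>.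
  The degree is \<open>0\<close> for an infinite extension.\<close>

definition ext_degree :: "('k::field \<Rightarrow> 'l::field) \<Rightarrow> nat"
  where "ext_degree \<iota> = vector_space.dim (\<lambda>a x. \<iota> a * x) UNIV"

definition is_min_poly :: "('k::field \<Rightarrow> 'l::field) \<Rightarrow> 'l \<Rightarrow> 'k poly \<Rightarrow> bool"
  where "is_min_poly \<iota> x f \<longleftrightarrow> lead_coeff f = 1 \<and> poly (map_poly \<iota> f) x = 0 \<and>
    (\<forall>g. g \<noteq> 0 \<and> poly (map_poly \<iota> g) x = 0 \<longrightarrow> degree f \<le> degree g)"

definition min_poly :: "('k::field \<Rightarrow> 'l::field) \<Rightarrow> 'l \<Rightarrow> 'k poly"
  where "min_poly \<iota> x = (THE f. is_min_poly \<iota> x f)"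

lemma is_min_poly_unique:
  assumes \<iota>: "field_hom \<iota>" and f: "is_min_poly \<iota> x f" and g: "is_min_poly \<iota> x g"
  shows "f = g"
proof (rule ccontr)
  interpret field_hom \<iota> by (rule \<iota>)
  assume "f \<noteq> g"
  have f0: "f \<noteq> 0" and g0: "g \<noteq> 0" using f g by (auto simp: is_min_poly_def)
  have deg: "degree f = degree g"
    using f g f0 g0 by (auto simp: is_min_poly_def intro!: antisym)
  have "map_poly \<iota> (f - g) = map_poly \<iota> f - map_poly \<iota> g"
    by (intro poly_eqI) (simp add: coeff_map_poly hom_minus)
  then have root: "poly (map_poly \<iota> (f - g)) x = 0"
    using f g by (simp add: is_min_poly_def)
  then have "degree f \<le> degree (f - g)"
    using f \<open>f \<noteq> g\<close> unfolding is_min_poly_def by auto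
  moreover have "degree (f - g) \<le> degree f"
    using deg by (metis degree_diff_le order_refl)
  ultimately have "degree (f - g) = degree f" by simp
  then have "lead_coeff (f - g) = 0"
    using f g deg by (simp add: is_min_poly_def)
  then show False using \<open>f \<noteq> g\<close> by (metis leading_coeff_0_iff right_minus_eq)
qed

lemma min_poly_eqI:
  assumes "field_hom \<iota>" "is_min_poly \<iota> x f"
  shows "min_poly \<iota> x = f"
  unfolding min_poly_def
  using assms is_min_poly_unique[OF assms(1)] by (intro the_equality) auto

text \<open>Separability over \<open>K\<close> of every element: its minimal polynomial has only simple roots in an
  algebraic closure of \<open>K\<close>.\<close>

definition separable_extension :: "('k::field \<Rightarrow> 'l::field) \<Rightarrow> bool"
  where "separable_extension \<iota> \<longleftrightarrow>
    (\<forall>x. rsquarefree (map_poly (to_ac :: 'k \<Rightarrow> 'k alg_closure) (min_poly \<iota> x)))"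

text \<open>The normalized valuation of \<open>L\<close> extends \<open>v\<^sub>K\<close> up to the ramification index as a factor.\<close>

definition totally_ramified ::
    "('k::field \<Rightarrow> 'l::field) \<Rightarrow> ('k \<Rightarrow> ereal) \<Rightarrow> ('l \<Rightarrow> ereal) \<Rightarrow> bool"
  where "totally_ramified \<iota> vK vL \<longleftrightarrow> (\<forall>a. vL (\<iota> a) = ereal (real (ext_degree \<iota>)) * vK a)"

definition is_automorphism_over :: "('k::field \<Rightarrow> 'l::field) \<Rightarrow> ('l \<Rightarrow> 'l) \<Rightarrow> bool"
  where "is_automorphism_over \<iota> \<sigma> \<longleftrightarrow> field_hom \<sigma> \<and> bij \<sigma> \<and> (\<forall>a. \<sigma> (\<iota> a) = \<iota> a)"

section \<open>Indices of inseparability and generalized Hasse-Herbrand functions\<close>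

text \<open>\<open>multiplicity p 0\<close> is \<open>0\<close> in the library, whereas \<open>v\<^sub>p(0) = \<infinity>\<close>.\<close>

definition vp_bar :: "nat \<Rightarrow> nat \<Rightarrow> int \<Rightarrow> nat"
  where "vp_bar p \<nu> k = (if k = 0 then \<nu> else min (multiplicity (int p) k) \<nu>)"

text \<open>The \<open>c\<^sub>h\<close> in \<open>f = X\<^sup>n - c\<^sub>1 X\<^sup>n\<^sup>-\<^sup>1 + \<dots> + (-1)\<^sup>n c\<^sub>n\<close>.\<close>

definition signed_coeff :: "nat \<Rightarrow> 'k::field poly \<Rightarrow> nat \<Rightarrow> 'k"
  where "signed_coeff n f h = (-1) ^ h * poly.coeff f (n - h)"

definition insep_index_at ::
    "('k::field \<Rightarrow> 'l::field) \<Rightarrow> ('k \<Rightarrow> ereal) \<Rightarrow> nat \<Rightarrow> nat \<Rightarrow> 'l \<Rightarrow> nat \<Rightarrow> ereal"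
  where "insep_index_at \<iota> vK p \<nu> \<pi> j =
    (let n = ext_degree \<iota>; c = signed_coeff n (min_poly \<iota> \<pi>) in
     Min {ereal (real n) * vK (c h) - ereal (real h) | h. h \<in> {1..n} \<and> vp_bar p \<nu> (int h) \<le> j})"

text \<open>In \<^typ>\<open>ereal\<close>, \<open>0 * \<infinity> = 0\<close> as required when \<open>v\<^sub>L(p) = \<infinity>\<close>. The argument \<open>\<pi>\<close> is the
  auxiliary uniformizer of \<open>L\<close> used to compute the index, which does not depend on it.\<close>

definition insep_index ::
    "('k::field \<Rightarrow> 'l::field) \<Rightarrow> ('k \<Rightarrow> ereal) \<Rightarrow> ('l \<Rightarrow> ereal) \<Rightarrow> nat \<Rightarrow> nat \<Rightarrow> 'l \<Rightarrow> nat \<Rightarrow> ereal"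
  where "insep_index \<iota> vK vL p \<nu> \<pi> j =
    Min {insep_index_at \<iota> vK p \<nu> \<pi> j' + ereal (real (j' - j)) * vL (of_nat p) | j'. j' \<in> {j..\<nu>}}"

text \<open>The indices are finite, so \<^const>\<open>real_of_ereal\<close> only changes their type.\<close>

definition hasse_herbrand_tilde ::
    "('k::field \<Rightarrow> 'l::field) \<Rightarrow> ('k \<Rightarrow> ereal) \<Rightarrow> ('l \<Rightarrow> ereal) \<Rightarrow> nat \<Rightarrow> nat \<Rightarrow> 'l \<Rightarrow> nat \<Rightarrow> real \<Rightarrow> real"
  where "hasse_herbrand_tilde \<iota> vK vL p \<nu> \<pi> j x =
    real_of_ereal (insep_index \<iota> vK vL p \<nu> \<pi> j) + real p ^ j * x"

definition hasse_herbrand ::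
    "('k::field \<Rightarrow> 'l::field) \<Rightarrow> ('k \<Rightarrow> ereal) \<Rightarrow> ('l \<Rightarrow> ereal) \<Rightarrow> nat \<Rightarrow> nat \<Rightarrow> 'l \<Rightarrow> nat \<Rightarrow> real \<Rightarrow> real"
  where "hasse_herbrand \<iota> vK vL p \<nu> \<pi> j x =
    Min {hasse_herbrand_tilde \<iota> vK vL p \<nu> \<pi> j0 x | j0. j0 \<in> {0..j}}"

definition rho ::
    "('k::field \<Rightarrow> 'l::field) \<Rightarrow> ('k \<Rightarrow> ereal) \<Rightarrow> ('l \<Rightarrow> ereal) \<Rightarrow> nat \<Rightarrow> nat \<Rightarrow> 'l \<Rightarrow> nat \<Rightarrow> nat \<Rightarrow> int"
  where "rho \<iota> vK vL p \<nu> \<pi> h l =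
    (let j = vp_bar p \<nu> (int h) in
     \<lceil>(hasse_herbrand \<iota> vK vL p \<nu> \<pi> j (real l) + real h) / real (ext_degree \<iota>)\<rceil>)"

end

theory Submission
  imports Defs "HOL-Library.Poly_Mapping" "Jordan_Normal_Form.Char_Poly"
begin

text \<open>Write \<open>n\<close> for the degree and let \<open>\<tau>\<close> be the uniformizer of \<open>L\<close> from which the indices \<open>i\<^sub>j\<close> are
computed, with minimal polynomial \<open>f\<^sub>\<tau>\<close> over \<open>K\<close> and \<open>c\<^sub>h\<close> the signed coefficients of \<open>f\<^sub>\<tau>\<close>. Replacing
\<open>\<pi>'\<close> by its conjugate \<open>\<sigma> \<pi>'\<close>, which has the same minimal polynomial, one may assume
\<open>\<pi>' = \<pi> + \<epsilon>\<close> with \<open>v\<^sub>L(\<epsilon>) \<ge> l + 1\<close>. Both minimal polynomials are characteristic polynomials of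
multiplication operators. Expand \<open>\<pi> = \<Sum> b\<^sub>m \<tau>\<^sup>m\<close> and \<open>\<epsilon> = \<Sum> d\<^sub>m \<tau>\<^sup>m\<close> with \<open>m < n\<close> and coefficients in
\<open>K\<close>; total ramification makes the valuations of the nonzero terms pairwise distinct, so every term
is at least as divisible as the sum.

Consider the generic situation: the norm \<open>G\<close> of \<open>\<Sum>\<^sub>i T\<^sub>i X\<^bsup>m i\<^esup>\<close>, where \<open>X\<close> is a root of a monic
polynomial of degree \<open>n\<close> with indeterminate coefficients \<open>C\<^sub>1, ..., C\<^sub>n\<close> (\<open>C\<^sub>h\<close> belongs to
\<open>X\<^sup>n\<^sup>-\<^sup>h\<close>). It is a polynomial over the integers in the \<open>T\<^sub>i\<close> and \<open>C\<^sub>h\<close>. The key fact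
(\<open>generic_norm_dvd\<close>) is: if \<open>q\<close> divides \<open>n\<close> and every \<open>C\<^sub>h\<close> occurring in a monomial of \<open>G\<close> has
\<open>q\<close> dividing \<open>h\<close>, then \<open>q\<close> divides the exponent of each \<open>T\<^sub>i\<close> in that monomial times its
coefficient. To see this, set the other \<open>C\<^sub>h\<close> to zero, so that the defining polynomial becomes a
polynomial in \<open>X\<^sup>q\<close>. Applying the derivation \<open>T\<^sub>i \<partial>/\<partial>T\<^sub>i\<close> to the determinant \<open>G\<close> gives a trace of a
matrix commuting with the companion matrix, and the diagonal of such a matrix is constant on blocks
of \<open>q\<close> consecutive entries (\<open>trace_commutes_companion_dvd\<close>, \<open>derivation_det_dvd\<close>).

The coefficients of the two characteristic polynomials are values of \<open>G\<close>
(\<open>coeff_char_poly_power_comb\<close>). After rescaling the basis by powers of \<open>\<tau>\<close>, the values substituted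
for the variables are the following: \<open>c\<^sub>h \<tau>\<^sup>-\<^sup>h\<close> up to sign for \<open>C\<^sub>h\<close>, of valuation
\<open>n v\<^sub>K(c\<^sub>h) - h \<ge> 0\<close>; the terms of \<open>\<pi>/\<tau>\<close>, of valuation \<open>\<ge> 0\<close>; and those of \<open>\<epsilon>/\<tau>\<close>, of valuation
\<open>\<ge> l\<close>. In the difference of the two coefficients of index \<open>n - h\<close> only monomials containing an
\<open>\<epsilon>\<close>-variable survive. Let \<open>p\<^bsup>j0\<^esup>\<close>, \<open>j0 \<le> \<nu>\<close>, be the largest power of \<open>p\<close> dividing all \<open>T\<close>-exponents
of such a monomial. The \<open>\<epsilon>\<close>-variable contributes at least \<open>p\<^bsup>j0\<^esup> l\<close>. If \<open>t\<close> is the least value of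
\<open>vp_bar p \<nu>\<close> on the indices \<open>h'\<close> of the \<open>C\<close>-variables that occur, with \<open>t = \<nu>\<close> if there are none, the key fact makes the
integer coefficient divisible by \<open>p\<^bsup>t - j0\<^esup>\<close> when \<open>t > j0\<close>; so the coefficient and the \<open>C\<close>-part together contribute at
least \<open>i\<^bsub>j0\<^esub>\<close>, directly by the definition of the index of inseparability. Finally \<open>p\<^bsup>j0\<^esup>\<close> divides \<open>n\<close>
and the exponent \<open>n - h\<close> of the variable that stands for the indeterminate, hence divides \<open>h\<close>; so
\<open>i\<^bsub>j0\<^esub> + p\<^bsup>j0\<^esup> l\<close> is one of the values whose minimum is the generalized Hasse-Herbrand function
(\<open>monomial_bound\<close>). As \<open>\<tau>\<close> is used throughout, the independence of the indices from the
uniformizer plays no role.\<close>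

section \<open>Traces and determinants of matrices commuting with a companion matrix\<close>

text \<open>The companion matrix of \<open>X\<^sup>n - \<Sum>\<^sub>j a\<^sub>j X\<^sup>j\<close>, in the orientation in which the column
\<open>(1, x, ..., x\<^sup>n\<^sup>-\<^sup>1)\<close> is an eigenvector for each root \<open>x\<close>. Only the values \<open>a j\<close> with \<open>j < n\<close> matter.\<close>

definition companion :: "nat \<Rightarrow> (nat \<Rightarrow> 'a::comm_ring_1) \<Rightarrow> 'a mat"
  where "companion n a =
    mat n n (\<lambda>(i, j). if Suc i = n then a j else if j = Suc i then 1 else 0)"

lemma companion_carrier [simp]: "companion n a \<in> carrier_mat n n"
  by (simp add: companion_def)

lemma companion_dim [simp]: "dim_row (companion n a) = n" "dim_col (companion n a) = n"
  by (simp_all add: companion_def)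

lemma commutes_companion_diag:
  assumes Y: "Y \<in> carrier_mat n n" and comm: "companion n a * Y = Y * companion n a"
    and b: "Suc b < n" and a: "a (Suc b) = 0"
  shows "Y $$ (Suc b, Suc b) = Y $$ (b, b)"
proof -
  have "(companion n a * Y) $$ (b, Suc b) = (\<Sum>k<n. companion n a $$ (b, k) * Y $$ (k, Suc b))"
    using Y b by (simp add: scalar_prod_def atLeast0LessThan)
  also have "\<dots> = (\<Sum>k<n. (if k = Suc b then Y $$ (k, Suc b) else 0))"
    using b by (intro sum.cong) (auto simp: companion_def)
  also have "\<dots> = Y $$ (Suc b, Suc b)" using b by simp
  finally have 1: "(companion n a * Y) $$ (b, Suc b) = Y $$ (Suc b, Suc b)" .
  have "(Y * companion n a) $$ (b, Suc b) = (\<Sum>k<n. Y $$ (b, k) * companion n a $$ (k, Suc b))"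
    using Y b by (simp add: scalar_prod_def atLeast0LessThan)
  also have "\<dots> = (\<Sum>k<n. (if k = b then Y $$ (b, k) else 0))"
    using b a by (intro sum.cong) (auto simp: companion_def)
  also have "\<dots> = Y $$ (b, b)" using b by simp
  finally show ?thesis using 1 comm by simp
qed

text \<open>The hypothesis on \<open>a\<close> says that \<open>X\<^sup>n - \<Sum>\<^sub>j a\<^sub>j X\<^sup>j\<close> is a polynomial in \<open>X\<^sup>q\<close>. For the matrix of
multiplication by an element of the algebra defined by this polynomial, the trace passes through the
subalgebra generated by \<open>X\<^sup>q\<close>, over which the algebra is free of rank \<open>q\<close>; this accounts for the factor \<open>q\<close>.\<close>

lemma trace_commutes_companion_dvd:
  assumes Y: "Y \<in> carrier_mat n n" and comm: "companion n a * Y = Y * companion n a"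
    and q: "q dvd n" and a: "\<And>j. \<not> q dvd j \<Longrightarrow> a j = 0"
  shows "of_nat q dvd (\<Sum>i<n. Y $$ (i, i))"
proof (cases "q = 0")
  case True
  then show ?thesis using q by simp
next
  case False
  obtain k where n: "n = k * q" using q by (metis dvd_def mult.commute)
  have blk: "Y $$ (c * q + r, c * q + r) = Y $$ (c * q, c * q)" if "c < k" "r < q" for c r
    using that(2)
  proof (induction r)
    case (Suc r)
    have "c * q + Suc r < Suc c * q" using Suc.prems by simp
    also have "\<dots> \<le> n" unfolding n using that(1) by (intro mult_le_mono1) simp
    finally have lt: "Suc (c * q + r) < n" by simp
    have "\<not> q dvd Suc r" using Suc.prems by (auto dest: dvd_imp_le)
    then have "\<not> q dvd Suc (c * q + r)"
      by (metis add_Suc_right dvd_add_right_iff dvd_triv_right)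
    with commutes_companion_diag[OF Y comm lt a] Suc show ?case by simp
  qed simp
  have "(\<Sum>i<n. Y $$ (i, i)) = (\<Sum>c<k. \<Sum>i\<in>{c * q..<c * q + q}. Y $$ (i, i))"
    unfolding n by (rule sum.nat_group[symmetric])
  also have "\<dots> = (\<Sum>c<k. of_nat q * Y $$ (c * q, c * q))"
  proof (intro sum.cong refl)
    fix c assume c: "c \<in> {..<k}"
    have "(\<Sum>i\<in>{c * q..<c * q + q}. Y $$ (i, i)) = (\<Sum>i\<in>{c * q..<c * q + q}. Y $$ (c * q, c * q))"
    proof (intro sum.cong refl)
      fix i assume "i \<in> {c * q..<c * q + q}"
      then have "i = c * q + (i - c * q)" "i - c * q < q" by auto
      then show "Y $$ (i, i) = Y $$ (c * q, c * q)" using blk c by (metis lessThan_iff)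
    qed
    then show "(\<Sum>i\<in>{c * q..<c * q + q}. Y $$ (i, i)) = of_nat q * Y $$ (c * q, c * q)" by simp
  qed
  finally show ?thesis by (simp add: sum_distrib_left[symmetric])
qed

locale derivation =
  fixes D :: "'a::comm_ring_1 \<Rightarrow> 'a"
  assumes D_add: "D (x + y) = D x + D y"
    and D_mult: "D (x * y) = D x * y + x * D y"
begin

lemma D_0 [simp]: "D 0 = 0"
  using D_add[of 0 0] by simp

lemma D_1 [simp]: "D 1 = 0"
  using D_mult[of 1 1] by simp

lemma D_minus: "D (- x) = - D x"
  using D_add[of x "- x"] by (simp add: eq_neg_iff_add_eq_0 add.commute)

lemma D_sum: "D (sum f A) = (\<Sum>i\<in>A. D (f i))"
  by (induction A rule: infinite_finite_induct) (auto simp: D_add)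

lemma D_prod: "finite A \<Longrightarrow> D (prod f A) = (\<Sum>i\<in>A. D (f i) * prod f (A - {i}))"
proof (induction A rule: finite_induct)
  case (insert x F)
  have "(\<Sum>i\<in>F. D (f i) * prod f (insert x F - {i})) = f x * (\<Sum>i\<in>F. D (f i) * prod f (F - {i}))"
    unfolding sum_distrib_left
  proof (intro sum.cong refl)
    fix i assume i: "i \<in> F"
    then have "insert x F - {i} = insert x (F - {i})" using insert by auto
    then show "D (f i) * prod f (insert x F - {i}) = f x * (D (f i) * prod f (F - {i}))"
      using insert by (simp add: ac_simps)
  qed
  then show ?case using insert by (simp add: D_mult)
qed simp

lemma D_signof_mult: "D (signof p * x) = signof p * D x"
  by (simp add: sign_def D_minus)

lemma D_det:
  assumes A: "A \<in> carrier_mat n n"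
  shows "D (det A) = (\<Sum>i<n. \<Sum>j<n. D (A $$ (i, j)) * cofactor A i j)"
proof -
  \<comment> \<open>\<open>B i\<close> differentiates the row \<open>i\<close> only; Leibniz's rule gives \<open>D (det A) = \<Sum>\<^sub>i det (B i)\<close>.\<close>
  define B where "B i = mat n n (\<lambda>(r, c). if r = i then D (A $$ (r, c)) else A $$ (r, c))" for i
  have B: "B i \<in> carrier_mat n n" for i by (simp add: B_def)
  have "D (det A) = (\<Sum>p | p permutes {0..<n}. \<Sum>i<n. signof p *
      (D (A $$ (i, p i)) * (\<Prod>r\<in>{0..<n} - {i}. A $$ (r, p r))))"
    unfolding det_def'[OF A] by (simp add: D_sum D_signof_mult D_prod sum_distrib_left atLeast0LessThan)
  also have "\<dots> = (\<Sum>i<n. \<Sum>p | p permutes {0..<n}. signof p * (\<Prod>r\<in>{0..<n}. B i $$ (r, p r)))"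
  proof (subst sum.swap, intro sum.cong refl arg_cong2[of _ _ _ _ "(*)"])
    fix i p assume i: "i \<in> {..<n}" and "p \<in> {p. p permutes {0..<n}}"
    then have p: "\<And>r. r < n \<Longrightarrow> p r < n" by (auto simp: permutes_in_image)
    have "(\<Prod>r\<in>{0..<n}. B i $$ (r, p r)) = B i $$ (i, p i) * (\<Prod>r\<in>{0..<n} - {i}. B i $$ (r, p r))"
      using i by (intro prod.remove) auto
    also have "\<dots> = D (A $$ (i, p i)) * (\<Prod>r\<in>{0..<n} - {i}. A $$ (r, p r))"
      using i p by (intro arg_cong2[of _ _ _ _ "(*)"] prod.cong) (auto simp: B_def)
    finally show "D (A $$ (i, p i)) * (\<Prod>r\<in>{0..<n} - {i}. A $$ (r, p r)) = (\<Prod>r\<in>{0..<n}. B i $$ (r, p r))" by simp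
  qed
  also have "\<dots> = (\<Sum>i<n. det (B i))" by (simp add: det_def'[OF B])
  also have "\<dots> = (\<Sum>i<n. \<Sum>j<n. D (A $$ (i, j)) * cofactor A i j)"
  proof (intro sum.cong refl)
    fix i assume i: "i \<in> {..<n}"
    have "cofactor (B i) i j = cofactor A i j" if "j < n" for j
      unfolding cofactor_def using A i that
      by (intro arg_cong2[of _ _ _ _ "(*)"] refl arg_cong[of _ _ det] eq_matI)
        (auto simp: B_def mat_delete_def)
    then show "det (B i) = (\<Sum>j<n. D (A $$ (i, j)) * cofactor A i j)"
      using i by (subst laplace_expansion_row[OF B, of i]) (auto simp: B_def)
  qed
  finally show ?thesis .
qed

end

text \<open>Over a domain the adjugate is the inverse up to the nonzero scalar \<open>det A\<close>, so it has the same
commutant as \<open>A\<close>.\<close>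

lemma adj_mat_commute:
  fixes A :: "'a::idom mat"
  assumes A: "A \<in> carrier_mat n n" and M: "M \<in> carrier_mat n n"
    and comm: "M * A = A * M" and det: "det A \<noteq> 0"
  shows "M * adj_mat A = adj_mat A * M"
proof -
  note adj = adj_mat[OF A]
  have "det A \<cdot>\<^sub>m (M * adj_mat A) = (adj_mat A * A) * (M * adj_mat A)"
    using adj M by (simp add: mult_smult_assoc_mat[of _ n n _ n])
  also have "\<dots> = adj_mat A * (A * (M * adj_mat A))"
    using adj(1) A M by (intro assoc_mult_mat[of _ n n _ n _ n]) auto
  also have "A * (M * adj_mat A) = (A * M) * adj_mat A"
    using adj(1) A M by (intro assoc_mult_mat[symmetric, of _ n n _ n _ n]) auto
  also have "\<dots> = M * (A * adj_mat A)"
    unfolding comm[symmetric] using adj(1) A M by (intro assoc_mult_mat[of _ n n _ n _ n]) auto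
  also have "adj_mat A * (M * (A * adj_mat A)) = (adj_mat A * M) * (A * adj_mat A)"
    using adj(1) A M by (intro assoc_mult_mat[symmetric, of _ n n _ n _ n]) auto
  also have "\<dots> = det A \<cdot>\<^sub>m (adj_mat A * M)"
    unfolding adj(2) using adj(1) M mult_smult_distrib[of "adj_mat A * M" n n "1\<^sub>m n" n "det A"]
    by (simp add: right_mult_one_mat[of _ n n])
  finally have eq: "det A \<cdot>\<^sub>m (M * adj_mat A) = det A \<cdot>\<^sub>m (adj_mat A * M)" .
  show ?thesis
  proof (rule eq_matI)
    fix i j assume ij: "i < dim_row (adj_mat A * M)" "j < dim_col (adj_mat A * M)"
    then have "(det A \<cdot>\<^sub>m (M * adj_mat A)) $$ (i, j) = (det A \<cdot>\<^sub>m (adj_mat A * M)) $$ (i, j)"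
      using eq by simp
    then have "det A * (M * adj_mat A) $$ (i, j) = det A * (adj_mat A * M) $$ (i, j)"
      using adj M ij by simp
    then show "(M * adj_mat A) $$ (i, j) = (adj_mat A * M) $$ (i, j)" using det by simp
  qed (use adj M in auto)
qed

text \<open>By Jacobi's formula the derivative of \<open>det A\<close> is the trace of \<open>adj A \<cdot> D A\<close>. Both factors commute
with the companion matrix, whose entries are constants of \<open>D\<close>.\<close>

lemma derivation_det_dvd:
  fixes A :: "'a::idom mat"
  assumes "derivation D" and A: "A \<in> carrier_mat n n"
    and comm: "companion n a * A = A * companion n a" and det: "det A \<noteq> 0"
    and q: "q dvd n" and a: "\<And>j. \<not> q dvd j \<Longrightarrow> a j = 0"
    and Da: "\<And>j. j < n \<Longrightarrow> D (a j) = 0"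
  shows "of_nat q dvd D (det A)"
proof -
  interpret derivation D by fact
  let ?M = "companion n a"
  define Y where "Y = adj_mat A * map_mat D A"
  note adj = adj_mat[OF A]
  have Y: "Y \<in> carrier_mat n n" using adj A by (simp add: Y_def)
  have DM: "D (?M $$ (i, j)) = 0" if "i < n" "j < n" for i j
    using that by (simp add: companion_def Da)
  have comm': "?M * map_mat D A = map_mat D A * ?M"
  proof (rule eq_matI)
    fix i j assume ij: "i < dim_row (map_mat D A * ?M)" "j < dim_col (map_mat D A * ?M)"
    then have ij': "i < n" "j < n" using A by auto
    have "D ((?M * A) $$ (i, j)) = D ((A * ?M) $$ (i, j))" using comm by simp
    then show "(?M * map_mat D A) $$ (i, j) = (map_mat D A * ?M) $$ (i, j)"
      using A ij' by (simp add: scalar_prod_def D_sum D_mult DM)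
  qed (use A in auto)
  have "?M * Y = (?M * adj_mat A) * map_mat D A"
    unfolding Y_def using adj A by (simp add: assoc_mult_mat[of _ n n _ n _ n])
  also have "\<dots> = adj_mat A * (?M * map_mat D A)"
    unfolding adj_mat_commute[OF A companion_carrier comm det]
    using adj A by (simp add: assoc_mult_mat[of _ n n _ n _ n])
  also have "\<dots> = Y * ?M"
    unfolding comm' Y_def using adj A by (simp add: assoc_mult_mat[of _ n n _ n _ n])
  finally have "of_nat q dvd (\<Sum>i<n. Y $$ (i, i))"
    using Y q a by (intro trace_commutes_companion_dvd)
  also have "(\<Sum>i<n. Y $$ (i, i)) = (\<Sum>i<n. \<Sum>j<n. D (A $$ (j, i)) * cofactor A j i)"
    using A adj(1) unfolding Y_def
    by (intro sum.cong) (auto simp: scalar_prod_def adj_mat_def atLeast0LessThan mult.commute)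
  also have "\<dots> = D (det A)"
    unfolding D_det[OF A] by (rule sum.swap)
  finally show ?thesis .
qed

section \<open>Integer polynomials in several variables\<close>

lemma poly_mapping_induct_add [case_names zero single add]:
  fixes S :: "('e \<Rightarrow>\<^sub>0 'c::comm_monoid_add) \<Rightarrow> bool"
  assumes "S 0" "\<And>e c. S (Poly_Mapping.single e c)" "\<And>P Q. S P \<Longrightarrow> S Q \<Longrightarrow> S (P + Q)"
  shows "S P"
proof -
  have "P = (\<Sum>e\<in>Poly_Mapping.keys P. Poly_Mapping.single e (Poly_Mapping.lookup P e))"
    by (rule poly_mapping_eqI)
      (auto simp: lookup_sum lookup_single when_def not_in_keys_iff_lookup_eq_zero)
  moreover have "S (\<Sum>e\<in>E. Poly_Mapping.single e (Poly_Mapping.lookup P e))" if "finite E" for E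
    using that by (induction E rule: finite_induct) (auto intro: assms)
  ultimately show ?thesis by (metis finite_keys)
qed

lemma keys_add_nat: "Poly_Mapping.keys (e + e' :: 'v \<Rightarrow>\<^sub>0 nat) = Poly_Mapping.keys e \<union> Poly_Mapping.keys e'"
  by (auto simp: in_keys_iff lookup_add)

text \<open>Polynomials over the integers in variables of type \<open>'v\<close>: a monomial is its exponent function, of
finite support. For linearly ordered \<open>'v\<close> this ring is an integral domain.\<close>

type_synonym 'v int_mpoly = "('v \<Rightarrow>\<^sub>0 nat) \<Rightarrow>\<^sub>0 int"

text \<open>The variable with index \<open>v\<close>.\<close>

definition mvar :: "'v \<Rightarrow> 'v int_mpoly"
  where "mvar v = Poly_Mapping.single (Poly_Mapping.single v 1) 1"

text \<open>The value of the monomial with exponents \<open>e\<close> at the point \<open>a\<close>.\<close>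

definition monom_val :: "('v \<Rightarrow> 'a::comm_ring_1) \<Rightarrow> ('v \<Rightarrow>\<^sub>0 nat) \<Rightarrow> 'a"
  where "monom_val a e = (\<Prod>v\<in>Poly_Mapping.keys e. a v ^ Poly_Mapping.lookup e v)"

text \<open>Evaluation of an integer polynomial at a point with coordinates in a commutative ring.\<close>

definition insertion :: "('v \<Rightarrow> 'a::comm_ring_1) \<Rightarrow> 'v int_mpoly \<Rightarrow> 'a"
  where "insertion a P = (\<Sum>e\<in>Poly_Mapping.keys P. of_int (Poly_Mapping.lookup P e) * monom_val a e)"

lemma monom_val_superset:
  assumes "finite V" "Poly_Mapping.keys e \<subseteq> V"
  shows "monom_val a e = (\<Prod>v\<in>V. a v ^ Poly_Mapping.lookup e v)"
  unfolding monom_val_def using assms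
  by (intro prod.mono_neutral_left) (auto simp: in_keys_iff)

lemma monom_val_add: "monom_val a (e + e') = monom_val a e * monom_val a e'"
  using monom_val_superset[of "Poly_Mapping.keys e \<union> Poly_Mapping.keys e'" e a] monom_val_superset[of "Poly_Mapping.keys e \<union> Poly_Mapping.keys e'" e' a]
    monom_val_superset[of "Poly_Mapping.keys e \<union> Poly_Mapping.keys e'" "e + e'" a]
  by (simp add: keys_add_nat lookup_add power_add prod.distrib)

lemma insertion_superset:
  assumes "finite E" "Poly_Mapping.keys P \<subseteq> E"
  shows "insertion a P = (\<Sum>e\<in>E. of_int (Poly_Mapping.lookup P e) * monom_val a e)"
  unfolding insertion_def using assms
  by (intro sum.mono_neutral_left) (auto simp: in_keys_iff)

lemma insertion_add: "insertion a (P + Q) = insertion a P + insertion a Q"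
proof -
  have fin: "finite (Poly_Mapping.keys P \<union> Poly_Mapping.keys Q)" by simp
  show ?thesis
    using insertion_superset[OF fin, of P a] insertion_superset[OF fin, of Q a]
      insertion_superset[OF fin, of "P + Q" a] keys_add[of P Q]
    by (simp add: lookup_add sum.distrib distrib_right)
qed

lemma insertion_0 [simp]: "insertion a 0 = 0"
  by (simp add: insertion_def)

lemma insertion_single [simp]: "insertion a (Poly_Mapping.single e c) = of_int c * monom_val a e"
  by (simp add: insertion_def)

lemma insertion_mvar [simp]: "insertion a (mvar v) = a v"
  by (simp add: mvar_def monom_val_def)

lemma insertion_mult: "insertion a (P * Q) = insertion a P * insertion a Q"
proof (induction P rule: poly_mapping_induct_add)
  case (single e c)
  show ?case
    by (induction Q rule: poly_mapping_induct_add)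
      (auto simp: mult_single monom_val_add insertion_add algebra_simps)
qed (auto simp: insertion_add distrib_right)

lemma insertion_hom: "comm_ring_hom (insertion a)"
proof
  show "insertion a 1 = 1"
    using insertion_single[of a 0 1] by (simp add: monom_val_def)
qed (simp_all add: insertion_add insertion_mult)

text \<open>The substitution of \<open>0\<close> for all variables outside \<open>V\<close>, described by its effect on coefficients.\<close>

definition restrict_vars :: "'v set \<Rightarrow> 'v int_mpoly \<Rightarrow> 'v int_mpoly"
  where "restrict_vars V = Poly_Mapping.mapp (\<lambda>e c. if Poly_Mapping.keys e \<subseteq> V then c else 0)"

lemma lookup_restrict_vars:
  "Poly_Mapping.lookup (restrict_vars V P) e = (if Poly_Mapping.keys e \<subseteq> V then Poly_Mapping.lookup P e else 0)"
  by (simp add: restrict_vars_def lookup_mapp when_def in_keys_iff)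

lemma restrict_vars_add: "restrict_vars V (P + Q) = restrict_vars V P + restrict_vars V Q"
  by (rule poly_mapping_eqI) (simp add: lookup_restrict_vars lookup_add)

lemma restrict_vars_0 [simp]: "restrict_vars V 0 = 0"
  by (rule poly_mapping_eqI) (simp add: lookup_restrict_vars)

lemma restrict_vars_single: "restrict_vars V (Poly_Mapping.single e c) =
    (if Poly_Mapping.keys e \<subseteq> V then Poly_Mapping.single e c else 0)"
  by (rule poly_mapping_eqI) (auto simp: lookup_restrict_vars lookup_single when_def)

lemma restrict_vars_mvar: "restrict_vars V (mvar v) = (if v \<in> V then mvar v else 0)"
  by (simp add: mvar_def restrict_vars_single)

lemma restrict_vars_mult: "restrict_vars V (P * Q) = restrict_vars V P * restrict_vars V Q"
proof (induction P rule: poly_mapping_induct_add)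
  case (single e c)
  show ?case
    by (induction Q rule: poly_mapping_induct_add)
      (auto simp: mult_single restrict_vars_single restrict_vars_add keys_add_nat algebra_simps)
qed (auto simp: restrict_vars_add distrib_right)

lemma restrict_vars_hom: "comm_ring_hom (restrict_vars V)"
proof
  show "restrict_vars V 1 = 1"
    using restrict_vars_single[of V 0 1] by simp
qed (simp_all add: restrict_vars_add restrict_vars_mult)

text \<open>The derivation \<open>T\<^sub>v \<partial>/\<partial>T\<^sub>v\<close>: it multiplies each coefficient by the exponent of \<open>T\<^sub>v\<close>, so divisibility of
\<open>euler_deriv v P\<close> can be read off monomial by monomial.\<close>

definition euler_deriv :: "'v \<Rightarrow> 'v int_mpoly \<Rightarrow> 'v int_mpoly"
  where "euler_deriv v = Poly_Mapping.mapp (\<lambda>e c. of_nat (Poly_Mapping.lookup e v) * c)"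

lemma lookup_euler_deriv: "Poly_Mapping.lookup (euler_deriv v P) e = of_nat (Poly_Mapping.lookup e v) * Poly_Mapping.lookup P e"
  by (simp add: euler_deriv_def lookup_mapp when_def in_keys_iff)

lemma euler_deriv_add: "euler_deriv v (P + Q) = euler_deriv v P + euler_deriv v Q"
  by (rule poly_mapping_eqI) (simp add: lookup_euler_deriv lookup_add algebra_simps)

lemma euler_deriv_0 [simp]: "euler_deriv v 0 = 0"
  by (rule poly_mapping_eqI) (simp add: lookup_euler_deriv)

lemma euler_deriv_single: "euler_deriv v (Poly_Mapping.single e c) =
    Poly_Mapping.single e (of_nat (Poly_Mapping.lookup e v) * c)"
  by (rule poly_mapping_eqI) (auto simp: lookup_euler_deriv lookup_single when_def)

lemma euler_deriv_mvar: "v \<noteq> w \<Longrightarrow> euler_deriv v (mvar w) = 0"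
  by (simp add: mvar_def euler_deriv_single lookup_single)

lemma derivation_euler_deriv: "derivation (euler_deriv v)"
proof
  show "euler_deriv v (P * Q) = euler_deriv v P * Q + P * euler_deriv v Q" for P Q
  proof (induction P rule: poly_mapping_induct_add)
    case (single e c)
    show ?case
    proof (induction Q rule: poly_mapping_induct_add)
      case (single e' c')
      then show ?case
        by (simp add: mult_single euler_deriv_single lookup_add single_add[symmetric] algebra_simps)
    qed (auto simp: euler_deriv_add algebra_simps)
  qed (auto simp: euler_deriv_add algebra_simps)
qed (rule euler_deriv_add)

lemma lookup_of_nat_mult:
  "Poly_Mapping.lookup (of_nat q * P :: 'v int_mpoly) e = of_nat q * Poly_Mapping.lookup P e"
  by (induction q) (simp_all add: distrib_right lookup_add)

section \<open>The norm of a generic element\<close>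

text \<open>The matrix \<open>\<Sum>\<^bsub>i < N\<^esub> t\<^sub>i M\<^bsup>m i\<^esup>\<close> for the companion matrix \<open>M\<close> of \<open>a\<close>: multiplication by
\<open>\<Sum>\<^sub>i t\<^sub>i x\<^bsup>m i\<^esup>\<close>, where \<open>x\<close> is the root adjoined.\<close>

definition power_comb :: "nat \<Rightarrow> nat \<Rightarrow> (nat \<Rightarrow> nat) \<Rightarrow> (nat \<Rightarrow> 'a) \<Rightarrow> (nat \<Rightarrow> 'a) \<Rightarrow> 'a::comm_ring_1 mat"
  where "power_comb n N m t a =
    mat n n (\<lambda>(r, s). \<Sum>i<N. t i * (companion n a ^\<^sub>m m i) $$ (r, s))"

lemma power_comb_carrier [simp]: "power_comb n N m t a \<in> carrier_mat n n"
  by (simp add: power_comb_def)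

lemma pow_mat_comm:
  assumes "A \<in> carrier_mat n n"
  shows "A * A ^\<^sub>m k = A ^\<^sub>m k * A"
proof (induction k)
  case (Suc k)
  have "A * (A ^\<^sub>m k * A) = (A * A ^\<^sub>m k) * A"
    using assms by (simp add: assoc_mult_mat[of _ n n _ n _ n])
  then show ?case using Suc by simp
qed (use assms in auto)

lemma power_comb_commutes: "companion n a * power_comb n N m t a = power_comb n N m t a * companion n a"
proof (rule eq_matI)
  let ?M = "companion n a"
  fix r s assume "r < dim_row (power_comb n N m t a * ?M)" "s < dim_col (power_comb n N m t a * ?M)"
  then have rs: "r < n" "s < n" by (auto simp: power_comb_def)
  have dims: "dim_row (?M ^\<^sub>m k) = n" "dim_col (?M ^\<^sub>m k) = n" for k
    using pow_carrier_mat[OF companion_carrier, of n a k] by auto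
  have L: "(?M * power_comb n N m t a) $$ (r, s) = (\<Sum>k<n. \<Sum>i<N. ?M $$ (r, k) * (t i * (?M ^\<^sub>m m i) $$ (k, s)))"
    using rs by (simp add: scalar_prod_def power_comb_def atLeast0LessThan sum_distrib_left)
  have R: "(power_comb n N m t a * ?M) $$ (r, s) = (\<Sum>k<n. \<Sum>i<N. (t i * (?M ^\<^sub>m m i) $$ (r, k)) * ?M $$ (k, s))"
    using rs by (simp add: scalar_prod_def power_comb_def atLeast0LessThan sum_distrib_right)
  have "(?M * power_comb n N m t a) $$ (r, s) = (\<Sum>i<N. t i * (?M * ?M ^\<^sub>m m i) $$ (r, s))"
    unfolding L using rs
    by (subst sum.swap) (simp add: scalar_prod_def atLeast0LessThan sum_distrib_left dims mult.left_commute)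
  also have "\<dots> = (\<Sum>i<N. t i * (?M ^\<^sub>m m i * ?M) $$ (r, s))"
    by (simp add: pow_mat_comm[OF companion_carrier])
  also have "\<dots> = (power_comb n N m t a * ?M) $$ (r, s)"
    unfolding R using rs
    by (subst sum.swap) (simp add: scalar_prod_def atLeast0LessThan sum_distrib_left dims mult.assoc)
  finally show "(?M * power_comb n N m t a) $$ (r, s) = (power_comb n N m t a * ?M) $$ (r, s)" .
qed (simp_all add: power_comb_def)

lemma (in comm_ring_hom) map_companion: "map_mat hom (companion n a) = companion n (\<lambda>j. hom (a j))"
  by (rule eq_matI) (auto simp: companion_def)

lemma (in comm_ring_hom) map_power_comb:
  "map_mat hom (power_comb n N m t a) = power_comb n N m (\<lambda>i. hom (t i)) (\<lambda>j. hom (a j))"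
proof (rule eq_matI)
  fix r s assume "r < dim_row (power_comb n N m (\<lambda>i. hom (t i)) (\<lambda>j. hom (a j)))"
    "s < dim_col (power_comb n N m (\<lambda>i. hom (t i)) (\<lambda>j. hom (a j)))"
  then have rs: "r < n" "s < n" by (auto simp: power_comb_def)
  have "hom ((companion n a ^\<^sub>m k) $$ (r, s)) = (companion n (\<lambda>j. hom (a j)) ^\<^sub>m k) $$ (r, s)" for k
  proof -
    have "dim_row (companion n a ^\<^sub>m k) = n" "dim_col (companion n a ^\<^sub>m k) = n"
      using pow_carrier_mat[OF companion_carrier, of n a k] by auto
    then have "hom ((companion n a ^\<^sub>m k) $$ (r, s)) = map_mat hom (companion n a ^\<^sub>m k) $$ (r, s)"
      using rs by simp
    then show ?thesis by (simp add: mat_hom_pow[OF companion_carrier] map_companion)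
  qed
  then show "map_mat hom (power_comb n N m t a) $$ (r, s) =
      power_comb n N m (\<lambda>i. hom (t i)) (\<lambda>j. hom (a j)) $$ (r, s)"
    using rs by (simp add: power_comb_def hom_sum hom_mult)
qed (simp_all add: power_comb_def)

text \<open>Variables are indexed by integers: the nonnegative \<open>i\<close> stands for \<open>T\<^sub>i\<close>, and \<open>-h\<close> with
\<open>1 \<le> h \<le> n\<close> stands for \<open>C\<^sub>h\<close>, the coefficient of \<open>X\<^sup>n\<^sup>-\<^sup>h\<close> in the relation \<open>X\<^sup>n = \<Sum>\<^sub>h C\<^sub>h X\<^sup>n\<^sup>-\<^sup>h\<close>.\<close>

definition generic_coeffs :: "nat \<Rightarrow> nat \<Rightarrow> int int_mpoly"
  where "generic_coeffs n j = (if j < n then mvar (- int (n - j)) else 0)"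

text \<open>The norm of \<open>\<Sum>\<^bsub>i < N\<^esub> T\<^sub>i X\<^bsup>m i\<^esup>\<close> as an integer polynomial in the \<open>T\<^sub>i\<close> and \<open>C\<^sub>h\<close>.\<close>

definition generic_norm :: "nat \<Rightarrow> nat \<Rightarrow> (nat \<Rightarrow> nat) \<Rightarrow> int int_mpoly"
  where "generic_norm n N m = det (power_comb n N m (\<lambda>i. mvar (int i)) (generic_coeffs n))"

lemma insertion_generic_norm:
  "insertion c (generic_norm n N m) =
    det (power_comb n N m (\<lambda>i. c (int i)) (\<lambda>j. if j < n then c (- int (n - j)) else 0))"
proof -
  interpret comm_ring_hom "insertion c" by (rule insertion_hom)
  have "(\<lambda>j. insertion c (generic_coeffs n j)) = (\<lambda>j. if j < n then c (- int (n - j)) else 0)"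
    by (auto simp: generic_coeffs_def)
  then show ?thesis
    unfolding generic_norm_def hom_det[symmetric] map_power_comb by simp
qed

text \<open>The hypothesis on \<open>e\<close> says that \<open>q\<close> divides \<open>h\<close> whenever \<open>C\<^sub>h\<close> occurs in the monomial. The condition
\<open>m 0 = 0\<close> provides a specialization \<open>T\<^sub>0 = 1\<close>, all other variables \<open>0\<close>, at which the norm is \<open>1\<close>; so
the norm is nonzero after any of the \<open>C\<^sub>h\<close> are set to zero.\<close>

lemma generic_norm_dvd:
  assumes q: "q dvd n" and N: "N > 0" and m0: "m 0 = 0"
    and e: "\<And>v. v \<in> Poly_Mapping.keys e \<Longrightarrow> v < 0 \<Longrightarrow> int q dvd v" and i: "i < N"
  shows "int q dvd int (Poly_Mapping.lookup e (int i)) * Poly_Mapping.lookup (generic_norm n N m) e"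
proof -
  \<comment> \<open>Setting \<open>C\<^sub>h = 0\<close> for \<open>q\<close> not dividing \<open>h\<close> does not change the coefficient at \<open>e\<close>.\<close>
  define V where "V = {v :: int. v < 0 \<longrightarrow> int q dvd v}"
  define a where "a j = restrict_vars V (generic_coeffs n j)" for j
  define A where "A = power_comb n N m (\<lambda>i. mvar (int i)) a"
  have A: "A \<in> carrier_mat n n" by (simp add: A_def)
  interpret r: comm_ring_hom "restrict_vars V" by (rule restrict_vars_hom)
  have a_eq: "a j = (if j < n \<and> q dvd j then mvar (- int (n - j)) else 0)" for j
  proof (cases "j < n")
    case True
    then have "int q dvd - int (n - j) \<longleftrightarrow> q dvd j"
      using q by (metis dvd_diff_nat dvd_minus_iff int_dvd_int_iff diff_diff_cancel less_imp_le)
    with True show ?thesis by (simp add: a_def generic_coeffs_def restrict_vars_mvar V_def)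
  next
    case False
    then show ?thesis by (simp add: a_def generic_coeffs_def)
  qed
  have detA: "restrict_vars V (generic_norm n N m) = det A"
    unfolding generic_norm_def r.hom_det[symmetric] r.map_power_comb A_def a_def
    by (simp add: restrict_vars_mvar V_def)
  have "det A \<noteq> 0"
  proof -
    define c :: "int \<Rightarrow> int" where "c v = (if v = 0 then 1 else 0)" for v
    interpret c: comm_ring_hom "insertion c" by (rule insertion_hom)
    have "map_mat (insertion c) A = 1\<^sub>m n"
      unfolding A_def c.map_power_comb
    proof (rule eq_matI)
      fix r s assume "r < dim_row (1\<^sub>m n)" "s < dim_col (1\<^sub>m n)"
      then have rs: "r < n" "s < n" by auto
      have "(\<Sum>i<N. c (int i) * (companion n (\<lambda>j. insertion c (a j)) ^\<^sub>m m i) $$ (r, s))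
          = (\<Sum>i<N. if i = 0 then (companion n (\<lambda>j. insertion c (a j)) ^\<^sub>m m i) $$ (r, s) else 0)"
        by (intro sum.cong) (auto simp: c_def)
      also have "\<dots> = 1\<^sub>m n $$ (r, s)" using N m0 by simp
      finally show "power_comb n N m (\<lambda>i. insertion c (mvar (int i))) (\<lambda>j. insertion c (a j)) $$ (r, s)
          = 1\<^sub>m n $$ (r, s)"
        using rs by (simp add: power_comb_def)
    qed (simp_all add: power_comb_def)
    then have "insertion c (det A) = 1" by (simp add: c.hom_det[symmetric])
    then show ?thesis by auto
  qed
  moreover have "companion n a * A = A * companion n a"
    unfolding A_def by (rule power_comb_commutes)
  ultimately have "of_nat q dvd euler_deriv (int i) (det A)"
    using derivation_euler_deriv A q
    by (intro derivation_det_dvd[where a = a and n = n]) (auto simp: a_eq euler_deriv_mvar)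
  then obtain Q where "euler_deriv (int i) (det A) = of_nat q * Q" by blast
  then have "Poly_Mapping.lookup (euler_deriv (int i) (det A)) e = int q * Poly_Mapping.lookup Q e"
    by (simp add: lookup_of_nat_mult)
  then have "int (Poly_Mapping.lookup e (int i)) * Poly_Mapping.lookup (det A) e = int q * Poly_Mapping.lookup Q e"
    by (simp add: lookup_euler_deriv)
  moreover have "Poly_Mapping.lookup (det A) e = Poly_Mapping.lookup (generic_norm n N m) e"
    unfolding detA[symmetric] lookup_restrict_vars using e by (auto simp: V_def)
  ultimately show ?thesis by simp
qed

section \<open>Elementary estimates for discrete valuations\<close>

context normalized_discrete_valuation
begin

lemma v_0 [simp]: "v 0 = \<infinity>"
  by (simp add: v_eq_top_iff)

lemma v_finite:
  assumes "x \<noteq> 0"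
  obtains k :: int where "v x = ereal (of_int k)"
  using v_int[OF assms] by blast

lemma v_not_MInf [simp]: "v x \<noteq> - \<infinity>"
  using v_int[of x] by (cases "x = 0") auto

lemma v_1 [simp]: "v 1 = 0"
proof -
  obtain k :: int where k: "v 1 = ereal (of_int k)" using v_finite[of 1] by auto
  have "v 1 = v 1 + v 1" using v_mult[of 1 1] by simp
  then show ?thesis using k by (simp add: zero_ereal_def)
qed

lemma v_minus [simp]: "v (- x) = v x"
proof -
  obtain k :: int where k: "v (- 1) = ereal (of_int k)" using v_finite[of "- 1"] by auto
  have "v (- 1) + v (- 1) = 0" using v_mult[of "- 1" "- 1"] by simp
  then have "v (- 1) = 0" using k by (simp add: zero_ereal_def)
  then show ?thesis using v_mult[of "- 1" x] by simp
qed

lemma v_minus_one_power_mult [simp]: "v ((- 1) ^ k * x) = v x"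
  by (induction k) auto

lemma v_add_ge: "c \<le> v x \<Longrightarrow> c \<le> v y \<Longrightarrow> c \<le> v (x + y)"
  using v_add[of x y] by (metis min.boundedI order_trans)

lemma v_sum_ge: "(\<And>i. i \<in> A \<Longrightarrow> c \<le> v (f i)) \<Longrightarrow> c \<le> v (sum f A)"
  by (induction A rule: infinite_finite_induct) (auto intro: v_add_ge)

lemma v_sum_greater:
  assumes "c < \<infinity>"
  shows "(\<And>i. i \<in> A \<Longrightarrow> c < v (f i)) \<Longrightarrow> c < v (sum f A)"
proof (induction A rule: infinite_finite_induct)
  case (insert x F)
  then have "c < min (v (f x)) (v (sum f F))" by simp
  also have "\<dots> \<le> v (f x + sum f F)" by (rule v_add)
  finally show ?case using insert by simp
qed (use assms in auto)

text \<open>If the nonzero summands have pairwise distinct valuations, the valuation of the sum is the least of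
them.\<close>

lemma v_sum_distinct:
  assumes A: "finite A" "i \<in> A"
    and distinct: "\<And>i j. i \<in> A \<Longrightarrow> j \<in> A \<Longrightarrow> i \<noteq> j \<Longrightarrow> f i \<noteq> 0 \<Longrightarrow> v (f i) \<noteq> v (f j)"
  shows "v (sum f A) \<le> v (f i)"
proof (cases "\<forall>j\<in>A. f j = 0")
  case True
  then show ?thesis using A by simp
next
  case False
  have "finite (v ` f ` A)" "v ` f ` A \<noteq> {}" using A by auto
  then obtain j where j: "j \<in> A" and min: "\<And>k. k \<in> A \<Longrightarrow> v (f j) \<le> v (f k)"
    using Min_in[of "v ` f ` A"] Min_le[of "v ` f ` A"] by (smt (verit) image_iff)
  obtain k where "k \<in> A" "f k \<noteq> 0" using False by blast
  then have "f j \<noteq> 0" using min[of k] v_eq_top_iff[of "f k"] by auto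
  then have fin: "v (f j) < \<infinity>" by (simp add: v_eq_top_iff)
  have "v (f j) < v (sum f (A - {j}))"
  proof (rule v_sum_greater[OF fin])
    fix k assume "k \<in> A - {j}"
    then show "v (f j) < v (f k)"
      using distinct[of j k] \<open>f j \<noteq> 0\<close> min[of k] j by (auto simp: order.strict_iff_order)
  qed
  moreover have "f j = sum f A - sum f (A - {j})" using A j by (simp add: sum.remove[of A j])
  ultimately have "v (sum f A) \<le> v (f j)"
    using v_add[of "sum f A" "- sum f (A - {j})"] by (auto simp: min_def split: if_splits)
  then show ?thesis using min[OF A(2)] by (rule order_trans)
qed

lemma v_power: "v (x ^ k) = ereal (real k) * v x"
proof (induction k)
  case (Suc k)
  then show ?case
    by (cases "v x") (auto simp: v_mult algebra_simps)
qed (simp add: zero_ereal_def[symmetric])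

lemma v_inverse: "x \<noteq> 0 \<Longrightarrow> v (inverse x) = - v x"
proof -
  assume x: "x \<noteq> 0"
  then obtain k l :: int where "v x = ereal (of_int k)" "v (inverse x) = ereal (of_int l)"
    by (metis v_finite inverse_nonzero_iff_nonzero)
  moreover have "v x + v (inverse x) = 0" using v_mult[of x "inverse x"] x by simp
  ultimately show ?thesis by (simp add: zero_ereal_def)
qed

lemma v_of_nat_nonneg [simp]: "0 \<le> v (of_nat k)"
  by (induction k) (auto intro: v_add_ge)

lemma v_of_int_nonneg [simp]: "0 \<le> v (of_int k)"
  by (cases k) (auto simp del: of_nat_Suc)

lemma v_of_int_dvd:
  assumes "int p ^ k dvd c"
  shows "ereal (real k) * v (of_nat p) \<le> v (of_int c)"
proof -
  obtain d where "c = int p ^ k * d" using assms by blast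
  then have "v (of_int c) = ereal (real k) * v (of_nat p) + v (of_int d)"
    by (simp add: v_mult v_power)
  then show ?thesis using v_of_int_nonneg[of d] by (metis add.right_neutral add_left_mono)
qed

lemma v_prod_nonneg: "(\<And>i. i \<in> A \<Longrightarrow> 0 \<le> v (f i)) \<Longrightarrow> 0 \<le> v (prod f A)"
  by (induction A rule: infinite_finite_induct) (auto simp: v_mult)

lemma v_prod_ge:
  assumes "finite A" "i \<in> A" "\<And>i. i \<in> A \<Longrightarrow> 0 \<le> v (f i)"
  shows "v (f i) \<le> v (prod f A)"
proof -
  have "v (prod f A) = v (f i) + v (prod f (A - {i}))"
    using assms by (simp add: prod.remove v_mult)
  moreover have "0 \<le> v (prod f (A - {i}))" using assms by (intro v_prod_nonneg) auto
  ultimately show ?thesis by (metis add.right_neutral add_left_mono)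
qed

lemma v_power_nonneg: "0 \<le> v x \<Longrightarrow> 0 \<le> v (x ^ k)"
  by (simp add: v_power)

lemma v_power_ge: "0 \<le> v x \<Longrightarrow> k > 0 \<Longrightarrow> v x \<le> v (x ^ k)"
  by (induction k) (auto simp: v_mult v_power intro: add_increasing2)

end

section \<open>Uniformizers of totally ramified extensions\<close>

lemma poly_eq_sum_lessThan:
  fixes g :: "'a::comm_ring_1 poly"
  assumes "Polynomial.degree g < n"
  shows "poly g x = (\<Sum>m<n. poly.coeff g m * x ^ m)"
  unfolding poly_altdef using assms
  by (intro sum.mono_neutral_left) (auto simp: coeff_eq_0)

text \<open>Finiteness of the extension is expressed by \<open>n > 0\<close>, since \<^const>\<open>ext_degree\<close> is \<open>0\<close> for infinite
extensions.\<close>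

locale totally_ramified_extension =
  field_hom \<iota> + K: normalized_discrete_valuation vK + L: normalized_discrete_valuation vL
  for \<iota> :: "'k::field \<Rightarrow> 'l::field" and vK vL +
  fixes n :: nat
  assumes degree_eq: "ext_degree \<iota> = n" and n_pos: "n > 0"
    and ramified: "vL (\<iota> a) = ereal (real n) * vK a"
begin

lemma vL_term:
  assumes "uniformizer vL x"
  shows "vL (\<iota> b * x ^ m) = ereal (real n) * vK b + ereal (real m)"
  using assms by (simp add: L.v_mult L.v_power ramified uniformizer_def one_ereal_def)

lemma vL_term_distinct:
  assumes x: "uniformizer vL x" and m: "m < n" "m' < n" "m \<noteq> m'" and b: "b \<noteq> 0"
  shows "vL (\<iota> b * x ^ m) \<noteq> vL (\<iota> b' * x ^ m')"
proof
  assume eq: "vL (\<iota> b * x ^ m) = vL (\<iota> b' * x ^ m')"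
  obtain k where k: "vK b = ereal (of_int k)" using b by (rule K.v_finite)
  have "b' \<noteq> 0" using eq k n_pos by (auto simp: vL_term[OF x])
  then obtain k' where k': "vK b' = ereal (of_int k')" by (rule K.v_finite)
  have "real_of_int (int n * k + int m) = real_of_int (int n * k' + int m')"
    using eq k k' by (simp add: vL_term[OF x])
  then have "int n * k + int m = int n * k' + int m'" by (simp only: of_int_eq_iff)
  then have "(int n * k + int m) mod int n = (int n * k' + int m') mod int n" by simp
  then show False using m by simp
qed

lemma vL_expansion:
  assumes "uniformizer vL x" "m < n"
  shows "vL (\<Sum>m<n. \<iota> (b m) * x ^ m) \<le> vL (\<iota> (b m) * x ^ m)"
proof (rule L.v_sum_distinct)
  fix i j assume "i \<in> {..<n}" "j \<in> {..<n}" "i \<noteq> j" "\<iota> (b i) * x ^ i \<noteq> 0"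
  then show "vL (\<iota> (b i) * x ^ i) \<noteq> vL (\<iota> (b j) * x ^ j)"
    using assms(1) by (intro vL_term_distinct) auto
qed (use assms in auto)

lemma expansion_eq_0:
  assumes "uniformizer vL x" "(\<Sum>m<n. \<iota> (b m) * x ^ m) = 0" "m < n"
  shows "b m = 0"
proof -
  have "x \<noteq> 0" using assms(1) by (auto simp: uniformizer_def one_ereal_def)
  moreover have "vL (\<iota> (b m) * x ^ m) = \<infinity>"
    using vL_expansion[OF assms(1,3), of b] assms(2) by simp
  ultimately show ?thesis by (simp add: L.v_eq_top_iff)
qed

text \<open>The powers \<open>1, x, ..., x\<^sup>n\<^sup>-\<^sup>1\<close> of a uniformizer are linearly independent by \<open>expansion_eq_0\<close>, hence a
basis of \<open>L\<close> over \<open>K\<close>.\<close>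

lemma expansion_exists:
  assumes x: "uniformizer vL x"
  shows "\<exists>b. y = (\<Sum>m<n. \<iota> (b m) * x ^ m)"
proof -
  interpret vs: vector_space "\<lambda>a y. \<iota> a * y"
    by unfold_locales (simp_all add: distrib_left distrib_right hom_add hom_mult mult.assoc)
  have dim: "vs.dim UNIV = n" using degree_eq by (simp add: ext_degree_def)
  let ?S = "(\<lambda>m. x ^ m) ` {..<n}"
  have inj: "inj_on (\<lambda>m. x ^ m) {..<n}"
  proof (rule inj_onI)
    fix m m' assume "x ^ m = x ^ m'"
    then have "vL (x ^ m) = vL (x ^ m')" by simp
    then show "m = m'" using x by (simp add: L.v_power uniformizer_def one_ereal_def)
  qed
  have ind: "vs.independent ?S"
  proof
    assume "vs.dependent ?S"
    moreover have "finite ?S" by simp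
    ultimately have "\<exists>u. (\<exists>y\<in>?S. u y \<noteq> 0) \<and> (\<Sum>y\<in>?S. \<iota> (u y) * y) = 0"
      by (simp only: vs.dependent_finite)
    then obtain u where u: "\<exists>y\<in>?S. u y \<noteq> 0" "(\<Sum>y\<in>?S. \<iota> (u y) * y) = 0"
      by blast
    have "(\<Sum>m<n. \<iota> (u (x ^ m)) * x ^ m) = 0"
      using u(2) by (simp add: sum.reindex[OF inj])
    then have "u (x ^ m) = 0" if "m < n" for m
      using expansion_eq_0[OF x, of "\<lambda>m. u (x ^ m)"] that by simp
    with u(1) show False by auto
  qed
  have "y \<in> vs.span ?S"
  proof (rule ccontr)
    assume y: "y \<notin> vs.span ?S"
    then have ind': "vs.independent (insert y ?S)" using ind by (rule vs.independent_insertI)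
    obtain B where B: "vs.independent B" "UNIV \<subseteq> vs.span B" "card B = n"
      unfolding dim[symmetric] by (rule vs.basis_exists)
    then have "finite B" using n_pos by (intro card_ge_0_finite) simp
    moreover have "insert y ?S \<subseteq> vs.span B" by (rule subset_trans[OF subset_UNIV B(2)])
    ultimately have le: "card (insert y ?S) \<le> card B"
      by (intro conjunct2[OF vs.independent_span_bound[OF _ ind']])
    have "y \<notin> ?S" using y by (metis vs.span_base)
    then have "card (insert y ?S) = Suc (card ?S)" by (intro card_insert_disjoint) simp_all
    then have "card (insert y ?S) = Suc n" by (simp only: card_image[OF inj] card_lessThan)
    with le show False by (simp only: B(3) Suc_n_not_le_n)
  qed
  moreover have "finite ?S" by simp
  ultimately have "y \<in> range (\<lambda>u. \<Sum>y\<in>?S. \<iota> (u y) * y)"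
    by (simp only: vs.span_finite)
  then obtain u where "y = (\<Sum>y\<in>?S. \<iota> (u y) * y)" by blast
  also have "\<dots> = (\<Sum>m<n. \<iota> (u (x ^ m)) * x ^ m)"
    by (subst sum.reindex[OF inj]) (simp only: o_def)
  finally show ?thesis by (rule exI[where x = "\<lambda>m. u (x ^ m)"])
qed

lemma poly_map_eq_expansion:
  assumes "Polynomial.degree g < n"
  shows "poly (map_poly \<iota> g) x = (\<Sum>m<n. \<iota> (poly.coeff g m) * x ^ m)"
  using assms by (simp add: poly_eq_sum_lessThan)

lemma uniformizer_root_degree:
  assumes x: "uniformizer vL x" and g: "g \<noteq> 0" "poly (map_poly \<iota> g) x = 0"
  shows "n \<le> Polynomial.degree g"
proof (rule ccontr)
  assume "\<not> n \<le> Polynomial.degree g"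
  then have d: "Polynomial.degree g < n" by simp
  have "poly.coeff g (Polynomial.degree g) = 0"
    using expansion_eq_0[OF x _ d, of "poly.coeff g"] g(2) poly_map_eq_expansion[OF d, of x] by simp
  then show False using g(1) by simp
qed

lemma uniformizer_min_polyI:
  assumes x: "uniformizer vL x" and f: "lead_coeff f = 1" "Polynomial.degree f = n"
    "poly (map_poly \<iota> f) x = 0"
  shows "is_min_poly \<iota> x f"
  unfolding is_min_poly_def using f uniformizer_root_degree[OF x] by auto

lemma uniformizer_min_poly_exists:
  assumes x: "uniformizer vL x"
  shows "\<exists>f. is_min_poly \<iota> x f \<and> Polynomial.degree f = n"
proof -
  obtain b where b: "x ^ n = (\<Sum>m<n. \<iota> (b m) * x ^ m)" using expansion_exists[OF x] by blast
  define g where "g = (\<Sum>m<n. Polynomial.monom (b m) m)"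
  define f where "f = Polynomial.monom 1 n - g"
  have cg: "poly.coeff g k = (if k < n then b k else 0)" for k
    by (simp add: g_def coeff_sum)
  have cf: "poly.coeff f k = (if k < n then - b k else if k = n then 1 else 0)" for k
    by (simp add: f_def cg)
  have deg: "Polynomial.degree f = n"
  proof (rule antisym)
    show "Polynomial.degree f \<le> n" by (rule degree_le) (simp add: cf)
    show "n \<le> Polynomial.degree f" by (rule le_degree) (simp add: cf)
  qed
  have "poly (map_poly \<iota> f) x = (\<Sum>i\<le>n. \<iota> (poly.coeff f i) * x ^ i)"
    by (simp add: poly_altdef deg)
  also have "\<dots> = (\<Sum>i<n. \<iota> (poly.coeff f i) * x ^ i) + x ^ n"
    by (simp add: lessThan_Suc_atMost[symmetric] cf)
  also have "(\<Sum>i<n. \<iota> (poly.coeff f i) * x ^ i) = - (x ^ n)"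
    unfolding b by (simp add: cf sum_negf[symmetric] hom_uminus)
  finally have "poly (map_poly \<iota> f) x = 0" by simp
  then have "is_min_poly \<iota> x f" using x deg cf by (intro uniformizer_min_polyI) auto
  then show ?thesis using deg by blast
qed

lemma uniformizer_min_poly_degree:
  assumes x: "uniformizer vL x" and f: "is_min_poly \<iota> x f"
  shows "Polynomial.degree f = n"
  using uniformizer_min_poly_exists[OF x] is_min_poly_unique[OF field_hom_axioms f] by auto

lemma min_poly_relation:
  assumes x: "uniformizer vL x" and f: "is_min_poly \<iota> x f"
  shows "(\<Sum>i<n. \<iota> (- poly.coeff f i) * x ^ i) = x ^ n"
proof -
  note deg = uniformizer_min_poly_degree[OF x f]
  have "0 = (\<Sum>i\<le>n. \<iota> (poly.coeff f i) * x ^ i)"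
    using f deg by (simp add: poly_altdef is_min_poly_def)
  also have "\<dots> = (\<Sum>i<n. \<iota> (poly.coeff f i) * x ^ i) + x ^ n"
    using f deg by (simp add: lessThan_Suc_atMost[symmetric] is_min_poly_def)
  finally have "x ^ n = - (\<Sum>i<n. \<iota> (poly.coeff f i) * x ^ i)"
    by (metis add_eq_0_iff)
  then show ?thesis by (simp add: hom_uminus sum_negf)
qed

text \<open>The next two lemmas say that the minimal polynomial of a uniformizer is Eisenstein: in
\<open>min_poly_relation\<close> the power \<open>x\<^sup>n\<close> has valuation \<open>n\<close>, and the nonzero terms of the sum have distinct valuations.\<close>

lemma min_poly_coeff_val:
  assumes x: "uniformizer vL x" and f: "is_min_poly \<iota> x f" and m: "m < n"
  shows "ereal (real n) \<le> ereal (real n) * vK (poly.coeff f m) + ereal (real m)"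
  using vL_expansion[OF x m, of "\<lambda>i. - poly.coeff f i"] x
  unfolding min_poly_relation[OF x f] vL_term[OF x]
  by (simp add: L.v_power uniformizer_def one_ereal_def)

lemma min_poly_coeff_0_val:
  assumes x: "uniformizer vL x" and f: "is_min_poly \<iota> x f"
  shows "ereal (real n) * vK (poly.coeff f 0) \<le> ereal (real n)"
proof (rule ccontr)
  assume less: "\<not> ?thesis"
  have "ereal (real n) < vL (\<Sum>i<n. \<iota> (- poly.coeff f i) * x ^ i)"
  proof (rule L.v_sum_greater)
    fix i assume i: "i \<in> {..<n}"
    show "ereal (real n) < vL (\<iota> (- poly.coeff f i) * x ^ i)"
    proof (cases "i = 0")
      case True
      then show ?thesis using less by (simp add: ramified hom_uminus)
    next
      case False
      have t: "vL (\<iota> (- poly.coeff f i) * x ^ i) = ereal (real n) * vK (poly.coeff f i) + ereal (real i)"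
        by (simp only: vL_term[OF x] K.v_minus)
      show ?thesis
      proof (cases "poly.coeff f i = 0")
        case True
        then show ?thesis using n_pos unfolding t by simp
      next
        case nz: False
        then obtain k where k: "vK (poly.coeff f i) = ereal (of_int k)" by (rule K.v_finite)
        have "real_of_int (int n) \<le> real_of_int (int n * k + int i)"
          using min_poly_coeff_val[OF x f, of i] i k by simp
        then have "int n \<le> int n * k + int i" by (simp only: of_int_le_iff)
        \<comment> \<open>The two sides differ modulo \<open>n\<close> because \<open>0 < i < n\<close>.\<close>
        moreover have "int n \<noteq> int n * k + int i"
        proof
          assume "int n = int n * k + int i"
          then have "int n mod int n = (int n * k + int i) mod int n" by simp
          then show False using i \<open>i \<noteq> 0\<close> by simp
        qed
        ultimately have "int n < int n * k + int i" by simp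
        then have "real_of_int (int n) < real_of_int (int n * k + int i)" by (simp only: of_int_less_iff)
        then show ?thesis unfolding t k by simp
      qed
    qed
  qed simp
  then show False
    using x unfolding min_poly_relation[OF x f] by (simp add: L.v_power uniformizer_def one_ereal_def)
qed

end

section \<open>Characteristic polynomials as values of the generic norm\<close>

lemma det_rescale:
  fixes A B :: "'a::comm_ring_1 mat"
  assumes A: "A \<in> carrier_mat n n" and B: "B \<in> carrier_mat n n"
    and eq: "\<And>r s. r < n \<Longrightarrow> s < n \<Longrightarrow> d r * A $$ (r, s) = B $$ (r, s) * e s"
  shows "(\<Prod>r<n. d r) * det A = det B * (\<Prod>s<n. e s)"
proof -
  have "(\<Prod>r<n. d r) * det A = (\<Sum>p | p permutes {0..<n}. signof p * (\<Prod>i = 0..<n. d i * A $$ (i, p i)))"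
    by (simp add: det_def'[OF A] sum_distrib_left prod.distrib atLeast0LessThan ac_simps)
  also have "\<dots> = (\<Sum>p | p permutes {0..<n}. signof p * (\<Prod>i = 0..<n. B $$ (i, p i)) * (\<Prod>s<n. e s))"
  proof (intro sum.cong refl)
    fix p assume "p \<in> {p. p permutes {0..<n}}"
    then have p: "p permutes {0..<n}" by simp
    have "(\<Prod>i = 0..<n. d i * A $$ (i, p i)) = (\<Prod>i = 0..<n. B $$ (i, p i) * e (p i))"
      using permutes_in_image[OF p] by (intro prod.cong) (auto intro!: eq)
    also have "\<dots> = (\<Prod>i = 0..<n. B $$ (i, p i)) * (\<Prod>i = 0..<n. e i)"
      using prod.permute[OF p, of e] by (simp add: prod.distrib o_def)
    finally show "signof p * (\<Prod>i = 0..<n. d i * A $$ (i, p i)) =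
        signof p * (\<Prod>i = 0..<n. B $$ (i, p i)) * (\<Prod>s<n. e s)"
      by (simp add: atLeast0LessThan mult.assoc)
  qed
  also have "\<dots> = det B * (\<Prod>s<n. e s)"
    by (simp add: det_def'[OF B] sum_distrib_right)
  finally show ?thesis .
qed

lemma companion_cong:
  "(\<And>j. j < n \<Longrightarrow> a j = b j) \<Longrightarrow> companion n a = companion n b"
  by (rule eq_matI) (auto simp: companion_def)

lemma companion_power_dims [simp]:
  "dim_row (companion n a ^\<^sub>m k) = n" "dim_col (companion n a ^\<^sub>m k) = n"
  using pow_carrier_mat[OF companion_carrier, of n a k] by auto

lemma companion_power_Suc:
  assumes "r < n" "s < n"
  shows "(companion n a ^\<^sub>m Suc k) $$ (r, s) =
    (\<Sum>i<n. (companion n a ^\<^sub>m k) $$ (r, i) * companion n a $$ (i, s))"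
  using assms by (simp add: scalar_prod_def atLeast0LessThan)

text \<open>Conjugating the companion matrix of \<open>a\<close> by \<open>diag(1, y, ..., y\<^sup>n\<^sup>-\<^sup>1)\<close> gives \<open>y\<close> times the companion
matrix of the coefficients \<open>a\<^sub>j / y\<^sup>n\<^sup>-\<^sup>j\<close>, the relation satisfied by \<open>x / y\<close> when \<open>x\<close> is a root.\<close>

lemma companion_power_rescale:
  fixes a :: "nat \<Rightarrow> 'a::field"
  assumes "y \<noteq> 0" "r < n" "s < n"
  shows "y ^ (r + k) * (companion n (\<lambda>j. a j / y ^ (n - j)) ^\<^sub>m k) $$ (r, s) =
    (companion n a ^\<^sub>m k) $$ (r, s) * y ^ s"
  using assms(3)
proof (induction k arbitrary: s)
  case 0
  then show ?case using assms by auto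
next
  case (Suc k)
  let ?b = "\<lambda>j. a j / y ^ (n - j)"
  have step: "y * (y ^ i * companion n ?b $$ (i, s)) = companion n a $$ (i, s) * y ^ s" if "i < n" for i
  proof (cases "Suc i = n")
    case True
    then have "y * y ^ i = y ^ (n - s) * y ^ s"
      using Suc.prems by (simp add: power_add[symmetric] power_Suc[symmetric] del: power_Suc)
    with True assms(1) Suc.prems that show ?thesis
      by (simp add: companion_def mult.assoc[symmetric])
  next
    case False
    then show ?thesis using Suc.prems that by (simp add: companion_def)
  qed
  have "y ^ (r + Suc k) * (companion n ?b ^\<^sub>m Suc k) $$ (r, s) =
      (\<Sum>i<n. (y ^ (r + k) * (companion n ?b ^\<^sub>m k) $$ (r, i)) * (y * companion n ?b $$ (i, s)))"
    unfolding companion_power_Suc[OF assms(2) Suc.prems] sum_distrib_left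
    by (simp add: ac_simps)
  also have "\<dots> = (\<Sum>i<n. (companion n a ^\<^sub>m k) $$ (r, i) * (y * (y ^ i * companion n ?b $$ (i, s))))"
  proof (intro sum.cong refl)
    fix i assume "i \<in> {..<n}"
    then have "y ^ (r + k) * (companion n ?b ^\<^sub>m k) $$ (r, i) = (companion n a ^\<^sub>m k) $$ (r, i) * y ^ i"
      by (intro Suc.IH) simp
    then show "(y ^ (r + k) * (companion n ?b ^\<^sub>m k) $$ (r, i)) * (y * companion n ?b $$ (i, s)) =
        (companion n a ^\<^sub>m k) $$ (r, i) * (y * (y ^ i * companion n ?b $$ (i, s)))"
      by (simp only:) (simp add: ac_simps)
  qed
  also have "\<dots> = (\<Sum>i<n. (companion n a ^\<^sub>m k) $$ (r, i) * (companion n a $$ (i, s) * y ^ s))"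
    by (intro sum.cong refl) (simp only: step lessThan_iff)
  also have "\<dots> = (companion n a ^\<^sub>m Suc k) $$ (r, s) * y ^ s"
    unfolding companion_power_Suc[OF assms(2) Suc.prems] sum_distrib_right
    by (simp only: mult.assoc)
  finally show ?case .
qed

lemma companion_power_eigenvector:
  fixes x :: "'a::comm_ring_1"
  assumes root: "(\<Sum>i<n. a i * x ^ i) = x ^ n" and r: "r < n"
  shows "(\<Sum>s<n. (companion n a ^\<^sub>m k) $$ (r, s) * x ^ s) = x ^ (r + k)"
proof (induction k)
  case 0
  have "(\<Sum>s<n. 1\<^sub>m n $$ (r, s) * x ^ s) = (\<Sum>s<n. if s = r then x ^ s else 0)"
    using r by (intro sum.cong) auto
  then show ?case using r by simp
next
  case (Suc k)
  have row: "(\<Sum>s<n. companion n a $$ (i, s) * x ^ s) = x * x ^ i" if i: "i < n" for i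
  proof (cases "Suc i = n")
    case True
    then have "(\<Sum>s<n. companion n a $$ (i, s) * x ^ s) = (\<Sum>s<n. a s * x ^ s)"
      using i by (intro sum.cong) (auto simp: companion_def)
    then show ?thesis using root True by (metis power_Suc)
  next
    case False
    then have "(\<Sum>s<n. companion n a $$ (i, s) * x ^ s) = (\<Sum>s<n. if s = Suc i then x ^ s else 0)"
      using i by (intro sum.cong) (auto simp: companion_def)
    then show ?thesis using False i by simp
  qed
  have "(\<Sum>s<n. (companion n a ^\<^sub>m Suc k) $$ (r, s) * x ^ s) =
      (\<Sum>s<n. \<Sum>i<n. (companion n a ^\<^sub>m k) $$ (r, i) * (companion n a $$ (i, s) * x ^ s))"
    using r by (intro sum.cong refl) (simp only: companion_power_Suc lessThan_iff sum_distrib_right mult.assoc)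
  also have "\<dots> = (\<Sum>i<n. (companion n a ^\<^sub>m k) $$ (r, i) * (\<Sum>s<n. companion n a $$ (i, s) * x ^ s))"
    by (subst sum.swap) (simp only: sum_distrib_left)
  also have "\<dots> = (\<Sum>i<n. x * ((companion n a ^\<^sub>m k) $$ (r, i) * x ^ i))"
    by (intro sum.cong refl) (simp only: row lessThan_iff, simp only: ac_simps)
  also have "\<dots> = x ^ (r + Suc k)"
    unfolding sum_distrib_left[symmetric] Suc.IH by simp
  finally show ?case .
qed

text \<open>The column \<open>(1, x, ..., x\<^sup>n\<^sup>-\<^sup>1)\<close> is an eigenvector with eigenvalue \<open>\<Sum>\<^sub>i t\<^sub>i x\<^bsup>m i\<^esup>\<close>.\<close>

lemma power_comb_char_poly_root:
  fixes x :: "'a::field"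
  assumes root: "(\<Sum>i<n. a i * x ^ i) = x ^ n" and n: "n > 0"
  shows "poly (char_poly (power_comb n N m t a)) (\<Sum>i<N. t i * x ^ m i) = 0"
proof -
  let ?A = "power_comb n N m t a" and ?v = "vec n (\<lambda>i. x ^ i)"
  have "?A *\<^sub>v ?v = (\<Sum>i<N. t i * x ^ m i) \<cdot>\<^sub>v ?v"
  proof (rule eq_vecI)
    fix r assume "r < dim_vec ((\<Sum>i<N. t i * x ^ m i) \<cdot>\<^sub>v ?v)"
    then have r: "r < n" by simp
    have "(?A *\<^sub>v ?v) $ r = (\<Sum>s<n. \<Sum>i<N. t i * ((companion n a ^\<^sub>m m i) $$ (r, s) * x ^ s))"
      using r by (simp add: power_comb_def scalar_prod_def atLeast0LessThan sum_distrib_right mult.assoc)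
    also have "\<dots> = (\<Sum>i<N. t i * (\<Sum>s<n. (companion n a ^\<^sub>m m i) $$ (r, s) * x ^ s))"
      by (subst sum.swap) (simp only: sum_distrib_left)
    also have "\<dots> = (\<Sum>i<N. t i * x ^ m i) * x ^ r"
      by (simp only: companion_power_eigenvector[OF root r] power_add sum_distrib_right)
        (simp only: ac_simps)
    finally show "(?A *\<^sub>v ?v) $ r = ((\<Sum>i<N. t i * x ^ m i) \<cdot>\<^sub>v ?v) $ r" using r by simp
  qed (simp add: power_comb_def)
  moreover have "?v \<noteq> 0\<^sub>v n"
  proof
    assume "?v = 0\<^sub>v n"
    then have "?v $ 0 = 0\<^sub>v n $ 0" by simp
    then show False using n by simp
  qed
  ultimately have "eigenvalue ?A (\<Sum>i<N. t i * x ^ m i)"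
    unfolding eigenvalue_def eigenvector_def by (intro exI[of _ ?v]) (simp add: power_comb_def)
  then show ?thesis using eigenvalue_root_char_poly[OF power_comb_carrier] by blast
qed

lemma monom_val_monom:
  fixes c :: "'v \<Rightarrow> 'a::comm_ring_1"
  shows "monom_val (\<lambda>v. Polynomial.monom (c v) (if v = z then 1 else 0)) e =
    Polynomial.monom (monom_val c e) (Poly_Mapping.lookup e z)"
proof -
  have "monom_val (\<lambda>v. Polynomial.monom (c v) (if v = z then 1 else 0)) e =
      (\<Prod>v\<in>insert z (Poly_Mapping.keys e). Polynomial.monom (c v) (if v = z then 1 else 0) ^ Poly_Mapping.lookup e v)"
    by (intro monom_val_superset) auto
  also have "\<dots> = (\<Prod>v\<in>insert z (Poly_Mapping.keys e). Polynomial.monom (c v ^ Poly_Mapping.lookup e v)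
      (if v = z then Poly_Mapping.lookup e v else 0))"
    by (intro prod.cong) (auto simp: monom_power)
  also have "\<dots> = Polynomial.monom (\<Prod>v\<in>insert z (Poly_Mapping.keys e). c v ^ Poly_Mapping.lookup e v)
      (\<Sum>v\<in>insert z (Poly_Mapping.keys e). if v = z then Poly_Mapping.lookup e v else 0)"
  proof -
    have "(\<Prod>v\<in>V. Polynomial.monom (g v) (k v)) = Polynomial.monom (\<Prod>v\<in>V. g v) (\<Sum>v\<in>V. k v)"
      if "finite V" for V and g :: "'v \<Rightarrow> 'a" and k
      using that by (induction V rule: finite_induct) (auto simp: mult_monom)
    then show ?thesis by simp
  qed
  also have "(\<Prod>v\<in>insert z (Poly_Mapping.keys e). c v ^ Poly_Mapping.lookup e v) = monom_val c e"
    by (intro monom_val_superset[symmetric]) auto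
  also have "(\<Sum>v\<in>insert z (Poly_Mapping.keys e). if v = z then Poly_Mapping.lookup e v else 0) = Poly_Mapping.lookup e z"
    by simp
  finally show ?thesis .
qed

text \<open>The coefficients of the characteristic polynomial as values of the generic norm. The variable \<open>T\<^sub>0\<close>
belongs to the exponent \<open>m 0 = 0\<close> and plays the role of the indeterminate of the characteristic
polynomial, so the coefficient of degree \<open>k\<close> collects the monomials with \<open>T\<^sub>0\<close>-exponent \<open>k\<close>; accordingly
\<open>t 0 = 0\<close>, and \<open>c 0 = 1\<close> removes \<open>T\<^sub>0\<close> from the value. The other variables take their values after
rescaling by \<open>y\<close>, which produces the factor \<open>y\<^sup>n\<^sup>-\<^sup>k\<close>.\<close>

lemma coeff_char_poly_power_comb:
  fixes a t :: "nat \<Rightarrow> 'a::field"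
  assumes y: "y \<noteq> 0" and N: "N > 0" and m0: "m 0 = 0" and t0: "t 0 = 0" and k: "k \<le> n"
    and c0: "c 0 = 1"
    and cT: "\<And>i. 0 < i \<Longrightarrow> i < N \<Longrightarrow> c (int i) = - (t i * y ^ m i / y)"
    and cC: "\<And>h. 0 < h \<Longrightarrow> h \<le> n \<Longrightarrow> c (- int h) = a (n - h) / y ^ h"
  shows "poly.coeff (char_poly (power_comb n N m t a)) k = y ^ (n - k) *
    (\<Sum>e | e \<in> Poly_Mapping.keys (generic_norm n N m) \<and> Poly_Mapping.lookup e 0 = k.
      of_int (Poly_Mapping.lookup (generic_norm n N m) e) * monom_val c e)"
proof -
  let ?G = "generic_norm n N m"
  define c' where "c' v = (if v = 0 then 1 / y else 1) * c v" for v :: int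
  \<comment> \<open>The point of \<open>'a[X]\<close> at which the generic norm becomes \<open>det (X/y - A/y)\<close> for \<open>A\<close> in the rescaled basis.\<close>
  define C where "C v = Polynomial.monom (c' v) (if v = 0 then 1 else 0)" for v :: int
  let ?A = "power_comb n N m t a"
  define b where "b j = a j / y ^ (n - j)" for j
  define E where "E = power_comb n N m (\<lambda>i. C (int i)) (\<lambda>j. if j < n then C (- int (n - j)) else 0)"
  have const: "comm_ring_hom (\<lambda>x :: 'a. [:x:])" by unfold_locales auto
  have const': "semiring_hom (\<lambda>x :: 'a. [:x:])" by unfold_locales
  have sum_const: "(\<Sum>i\<in>I. [:g i:]) = [:\<Sum>i\<in>I. g i:]" for I :: "nat set" and g :: "nat \<Rightarrow> 'a"
    by (induction I rule: infinite_finite_induct) auto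
  have Cb: "C (- int (n - j)) = [:b j:]" if "j < n" for j
    using cC[of "n - j"] that unfolding C_def c'_def b_def
    by (simp only: neg_equal_0_iff_equal of_nat_eq_0_iff) (simp add: monom_0)
  have comp: "companion n (\<lambda>j. if j < n then C (- int (n - j)) else 0) = map_mat (\<lambda>x. [:x:]) (companion n b)"
    unfolding comm_ring_hom.map_companion[OF const] by (intro companion_cong) (simp only: Cb if_True)
  have E_entry: "E $$ (r, s) = (\<Sum>i<N. C (int i) * [:(companion n b ^\<^sub>m m i) $$ (r, s):])"
    if "r < n" "s < n" for r s
    using that by (simp add: E_def power_comb_def comp semiring_hom.mat_hom_pow[OF const' companion_carrier, symmetric])
  let ?Y = "\<Prod>s<n. [:y ^ s:]"
  have conj: "(\<Prod>r<n. [:y ^ Suc r:]) * det E = det (char_poly_matrix ?A) * (\<Prod>s<n. [:y ^ s:])"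
  proof (rule det_rescale)
    fix r s assume rs: "r < n" "s < n"
    obtain N' where N': "N = Suc N'" using N by (cases N) auto
    have "[:y ^ Suc r:] * E $$ (r, s) = [:y ^ Suc r:] * (C 0 * [:1\<^sub>m n $$ (r, s):])
        + (\<Sum>i<N'. [:y ^ Suc r:] * (C (int (Suc i)) * [:(companion n b ^\<^sub>m m (Suc i)) $$ (r, s):]))"
      using m0 unfolding E_entry[OF rs] N' sum.lessThan_Suc_shift
      by (simp add: distrib_left sum_distrib_left)
    also have "[:y ^ Suc r:] * (C 0 * [:1\<^sub>m n $$ (r, s):]) = ([:0, 1:] * 1\<^sub>m n $$ (r, s)) * [:y ^ s:]"
      using rs y by (auto simp: C_def c'_def c0 monom_Suc monom_0)
    also have "(\<Sum>i<N'. [:y ^ Suc r:] * (C (int (Suc i)) * [:(companion n b ^\<^sub>m m (Suc i)) $$ (r, s):])) =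
        (\<Sum>i<N'. [: - (t (Suc i) * (companion n a ^\<^sub>m m (Suc i)) $$ (r, s)) * y ^ s :])"
    proof (intro sum.cong refl)
      fix i assume "i \<in> {..<N'}"
      then have ct: "c (int (Suc i)) = - (t (Suc i) * y ^ m (Suc i) / y)" using N' by (intro cT) auto
      have "y ^ Suc r * (c (int (Suc i)) * (companion n b ^\<^sub>m m (Suc i)) $$ (r, s)) =
          - (t (Suc i) * (y ^ (r + m (Suc i)) * (companion n b ^\<^sub>m m (Suc i)) $$ (r, s)))"
        using y by (simp only: ct) (simp add: power_add)
      also have "\<dots> = - (t (Suc i) * (companion n a ^\<^sub>m m (Suc i)) $$ (r, s)) * y ^ s"
        unfolding b_def companion_power_rescale[OF y rs] by simp
      finally show "[:y ^ Suc r:] * (C (int (Suc i)) * [:(companion n b ^\<^sub>m m (Suc i)) $$ (r, s):]) =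
          [: - (t (Suc i) * (companion n a ^\<^sub>m m (Suc i)) $$ (r, s)) * y ^ s :]"
        by (simp add: C_def c'_def monom_0 ac_simps)
    qed
    also have "\<dots> = [: - ?A $$ (r, s) :] * [:y ^ s:]"
      using rs t0 unfolding sum_const N'
      by (simp add: power_comb_def sum.lessThan_Suc_shift sum_negf sum_distrib_right sum_distrib_left ac_simps del: sum.lessThan_Suc)
    also have "([:0, 1:] * 1\<^sub>m n $$ (r, s)) * [:y ^ s:] + [: - ?A $$ (r, s) :] * [:y ^ s:] =
        char_poly_matrix ?A $$ (r, s) * [:y ^ s:]"
      using rs by (simp add: char_poly_matrix_def power_comb_def distrib_right)
    finally show "[:y ^ Suc r:] * E $$ (r, s) = char_poly_matrix ?A $$ (r, s) * [:y ^ s:]" .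
  qed (simp_all add: E_def)
  have shift: "(\<Prod>r<n. [:y ^ Suc r:]) = [:y ^ n:] * (\<Prod>s<n. [:y ^ s:])"
  proof -
    have "(\<Prod>r<n. [:y ^ Suc r:]) = (\<Prod>r<n. [:y:] * [:y ^ r:])" by (intro prod.cong) auto
    also have "\<dots> = [:y:] ^ n * (\<Prod>s<n. [:y ^ s:])" by (simp only: prod.distrib prod_constant card_lessThan)
    finally show ?thesis by (simp add: poly_const_pow)
  qed
  have "?Y \<noteq> 0" using y by simp
  moreover have "([:y ^ n:] * det E) * ?Y = char_poly ?A * ?Y"
    using conj unfolding shift char_poly_def by (simp only: ac_simps)
  ultimately have cp: "char_poly ?A = [:y ^ n:] * det E"
    by (metis mult_right_cancel)
  have detE: "det E = insertion C ?G" by (simp add: insertion_generic_norm E_def)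
  have mv: "monom_val c' e = monom_val c e / y ^ Poly_Mapping.lookup e 0" for e
  proof -
    have "monom_val c' e = (\<Prod>v\<in>insert 0 (Poly_Mapping.keys e). c' v ^ Poly_Mapping.lookup e v)"
      by (intro monom_val_superset) auto
    also have "\<dots> = (\<Prod>v\<in>insert 0 (Poly_Mapping.keys e). if v = 0 then (1 / y) ^ Poly_Mapping.lookup e v else 1)
        * (\<Prod>v\<in>insert 0 (Poly_Mapping.keys e). c v ^ Poly_Mapping.lookup e v)"
      unfolding prod.distrib[symmetric] by (intro prod.cong) (auto simp: c'_def power_mult_distrib)
    also have "(\<Prod>v\<in>insert 0 (Poly_Mapping.keys e). c v ^ Poly_Mapping.lookup e v) = monom_val c e"
      by (intro monom_val_superset[symmetric]) auto
    finally show ?thesis by (simp add: power_divide)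
  qed
  have "poly.coeff (char_poly ?A) k = y ^ n * (\<Sum>e\<in>Poly_Mapping.keys ?G.
      of_int (Poly_Mapping.lookup ?G e) * (if Poly_Mapping.lookup e 0 = k then monom_val c' e else 0))"
    unfolding cp detE insertion_def C_def monom_val_monom
    by (simp add: coeff_sum of_int_poly)
  also have "\<dots> = y ^ n * (\<Sum>e | e \<in> Poly_Mapping.keys ?G \<and> Poly_Mapping.lookup e 0 = k.
      of_int (Poly_Mapping.lookup ?G e) * monom_val c e / y ^ k)"
    by (intro arg_cong2[of _ _ _ _ "(*)"] sum.mono_neutral_cong_right refl) (auto simp: mv)
  also have "\<dots> = (y ^ n / y ^ k) * (\<Sum>e | e \<in> Poly_Mapping.keys ?G \<and> Poly_Mapping.lookup e 0 = k.
      of_int (Poly_Mapping.lookup ?G e) * monom_val c e)"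
    by (simp add: sum_divide_distrib[symmetric])
  also have "y ^ n / y ^ k = y ^ (n - k)" using y k by (simp add: power_diff)
  finally show ?thesis .
qed

section \<open>Valuations of the monomials of the generic norm\<close>

lemma monom_val_cong:
  "(\<And>v. v \<in> Poly_Mapping.keys e \<Longrightarrow> c v = c' v) \<Longrightarrow> monom_val c e = monom_val c' e"
  unfolding monom_val_def by (intro prod.cong) auto

lemma monom_val_eq_0: "v \<in> Poly_Mapping.keys e \<Longrightarrow> c v = 0 \<Longrightarrow> monom_val c (e :: 'v \<Rightarrow>\<^sub>0 nat) = (0 :: 'a::idom)"
  unfolding monom_val_def by (auto simp: in_keys_iff intro!: bexI[of _ v])

lemma vp_bar_pos: "h > 0 \<Longrightarrow> vp_bar p \<nu> (int h) = min (multiplicity (int p) (int h)) \<nu>"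
  by (simp add: vp_bar_def)

lemma vp_bar_geI:
  assumes "prime p" "h > 0" "p ^ t dvd h" "t \<le> \<nu>"
  shows "t \<le> vp_bar p \<nu> (int h)"
proof -
  have "int p ^ t dvd int h" using assms(3) by (metis int_dvd_int_iff of_nat_power)
  then have "t \<le> multiplicity (int p) (int h)"
    using assms(1,2) prime_gt_1_nat[of p] by (intro multiplicity_geI) auto
  then show ?thesis using assms by (simp add: vp_bar_pos)
qed

lemma power_dvd_of_le_vp_bar:
  assumes "h > 0" "t \<le> vp_bar p \<nu> (int h)"
  shows "int (p ^ t) dvd int h"
  using assms by (simp add: vp_bar_pos multiplicity_dvd')

lemma sum_lessThan_add:
  fixes n k :: nat
  shows "(\<Sum>i<n + k. g i) = (\<Sum>i<n. g i) + (\<Sum>i<k. g (n + i) :: 'a::comm_monoid_add)"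
  by (induction k) (auto simp: add.assoc)

context totally_ramified_extension
begin

lemma insep_index_le:
  assumes h: "h \<in> {1..n}" "vp_bar p \<nu> (int h) \<le> t" and t: "j \<le> t" "t \<le> \<nu>"
  shows "insep_index \<iota> vK vL p \<nu> \<tau> j \<le>
    ereal (real n) * vK (poly.coeff (min_poly \<iota> \<tau>) (n - h)) - ereal (real h)
      + ereal (real (t - j)) * vL (of_nat p)"
proof -
  have "insep_index \<iota> vK vL p \<nu> \<tau> j \<le> insep_index_at \<iota> vK p \<nu> \<tau> t + ereal (real (t - j)) * vL (of_nat p)"
    unfolding insep_index_def using t by (intro Min_le CollectI exI[of _ t]) auto
  also have "insep_index_at \<iota> vK p \<nu> \<tau> t \<le>
      ereal (real n) * vK (signed_coeff n (min_poly \<iota> \<tau>) h) - ereal (real h)"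
    unfolding insep_index_at_def Let_def degree_eq using h by (intro Min_le) auto
  finally show ?thesis by (simp add: signed_coeff_def add_right_mono)
qed

lemma insep_index_nonneg:
  assumes \<tau>: "uniformizer vL \<tau>" and j: "j \<le> \<nu>"
  shows "0 \<le> insep_index \<iota> vK vL p \<nu> \<tau> j"
proof -
  obtain f where f: "is_min_poly \<iota> \<tau> f" using uniformizer_min_poly_exists[OF \<tau>] by blast
  then have mp: "min_poly \<iota> \<tau> = f" by (rule min_poly_eqI[OF field_hom_axioms])
  have at: "0 \<le> insep_index_at \<iota> vK p \<nu> \<tau> t" for t
  proof -
    let ?A = "{ereal (real n) * vK (signed_coeff n f h) - ereal (real h) | h. h \<in> {1..n} \<and> vp_bar p \<nu> (int h) \<le> t}"
    have "vp_bar p \<nu> (int 1) \<le> t" by (simp add: vp_bar_def)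
    then have "?A \<noteq> {}" using n_pos by fastforce
    moreover have "finite ?A" by simp
    moreover have "0 \<le> ereal (real n) * vK (signed_coeff n f h) - ereal (real h)" if "h \<in> {1..n}" for h
    proof -
      have "ereal (real n) \<le> ereal (real n) * vK (poly.coeff f (n - h)) + ereal (real (n - h))"
        using that by (intro min_poly_coeff_val[OF \<tau> f]) auto
      then show ?thesis using that
        by (cases "vK (poly.coeff f (n - h))") (auto simp: signed_coeff_def of_nat_diff n_pos)
    qed
    ultimately show ?thesis unfolding insep_index_at_def Let_def degree_eq mp
      by (subst Min_ge_iff) auto
  qed
  let ?B = "{insep_index_at \<iota> vK p \<nu> \<tau> j' + ereal (real (j' - j)) * vL (of_nat p) | j'. j' \<in> {j..\<nu>}}"
  have "?B \<noteq> {}" using j by auto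
  moreover have "finite ?B" by simp
  ultimately show ?thesis unfolding insep_index_def
    by (subst Min_ge_iff) (auto intro!: add_nonneg_nonneg at)
qed

text \<open>Holds also for an infinite index: \<^const>\<open>real_of_ereal\<close> replaces it by \<open>0\<close>, which only lowers the
left-hand side because the indices are nonnegative.\<close>

lemma hasse_herbrand_le:
  assumes \<tau>: "uniformizer vL \<tau>" and j: "j0 \<le> j" "j \<le> \<nu>"
  shows "ereal (hasse_herbrand \<iota> vK vL p \<nu> \<tau> j x) \<le> insep_index \<iota> vK vL p \<nu> \<tau> j0 + ereal (real p ^ j0 * x)"
proof -
  have "hasse_herbrand \<iota> vK vL p \<nu> \<tau> j x \<le> hasse_herbrand_tilde \<iota> vK vL p \<nu> \<tau> j0 x"
    unfolding hasse_herbrand_def using j by (intro Min_le) auto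
  moreover have "0 \<le> insep_index \<iota> vK vL p \<nu> \<tau> j0" using j by (intro insep_index_nonneg[OF \<tau>]) simp
  ultimately show ?thesis
    by (cases "insep_index \<iota> vK vL p \<nu> \<tau> j0") (auto simp: hasse_herbrand_tilde_def)
qed

lemma hasse_herbrand_nonneg:
  assumes \<tau>: "uniformizer vL \<tau>" and j: "j \<le> \<nu>" and x: "x \<ge> 0"
  shows "0 \<le> hasse_herbrand \<iota> vK vL p \<nu> \<tau> j x"
proof -
  let ?A = "{hasse_herbrand_tilde \<iota> vK vL p \<nu> \<tau> j0 x | j0. j0 \<in> {0..j}}"
  have "?A \<noteq> {}" by auto
  moreover have "finite ?A" by simp
  moreover have "0 \<le> hasse_herbrand_tilde \<iota> vK vL p \<nu> \<tau> j0 x" if "j0 \<le> j" for j0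
    unfolding hasse_herbrand_tilde_def using insep_index_nonneg[OF \<tau>, of j0 \<nu> p] that j x
    by (intro add_nonneg_nonneg mult_nonneg_nonneg real_of_ereal_pos) auto
  ultimately show ?thesis unfolding hasse_herbrand_def by (subst Min_ge_iff) auto
qed

text \<open>The contribution of a single monomial. The point \<open>c\<close> takes the values \<open>-a\<^bsub>n-h\<^esub> \<tau>\<^sup>-\<^sup>h\<close>, with \<open>a\<^bsub>n-h\<^esub>\<close>
the coefficients of the minimal polynomial of \<open>\<tau>\<close>, at the variables \<open>C\<^sub>h\<close>, and integral values at the variables
\<open>T\<^sub>i\<close>; the variable \<open>v0\<close>, at which the value is divisible by \<open>\<tau>\<^sup>l\<close>, occurs in the monomial.\<close>

lemma monomial_bound:
  assumes p: "prime p" "p ^ \<nu> dvd n" and N: "N > 0" and m0: "m 0 = 0"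
    and \<tau>: "uniformizer vL \<tau>" and f: "is_min_poly \<iota> \<tau> f"
    and cC: "\<And>h. 0 < h \<Longrightarrow> h \<le> n \<Longrightarrow> c (- int h) = \<iota> (- poly.coeff f (n - h)) / \<tau> ^ h"
    and c_out: "\<And>v. v < - int n \<or> int N \<le> v \<Longrightarrow> c v = 0"
    and c_nonneg: "\<And>v. 0 \<le> v \<Longrightarrow> 0 \<le> vL (c v)"
    and v0: "v0 \<in> Poly_Mapping.keys e" "0 \<le> v0" "ereal (real l) \<le> vL (c v0)"
    and h: "h \<in> {1..n}" "Poly_Mapping.lookup e 0 = n - h"
  shows "ereal (hasse_herbrand \<iota> vK vL p \<nu> \<tau> (vp_bar p \<nu> (int h)) (real l)) \<le>
    vL (of_int (Poly_Mapping.lookup (generic_norm n N m) e) * monom_val c e)"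
proof (cases "\<exists>v\<in>Poly_Mapping.keys e. c v = 0")
  case True
  then show ?thesis by (auto simp: monom_val_eq_0)
next
  case False
  let ?G = "generic_norm n N m" and ?I = "insep_index \<iota> vK vL p \<nu> \<tau>"
  have range: "- int n \<le> v" "v < int N" if "v \<in> Poly_Mapping.keys e" for v
    using False that c_out[of v] by fastforce+
  have mp: "min_poly \<iota> \<tau> = f" by (rule min_poly_eqI[OF field_hom_axioms f])
  have \<tau>0: "\<tau> \<noteq> 0" using \<tau> by (auto simp: uniformizer_def one_ereal_def)
  \<comment> \<open>\<open>p ^ j0\<close> is the largest power of \<open>p\<close>, with exponent at most \<open>\<nu>\<close>, dividing all \<open>T\<close>-exponents.\<close>
  define J where "J = {j. j \<le> \<nu> \<and> (\<forall>i<N. p ^ j dvd Poly_Mapping.lookup e (int i))}"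
  define j0 where "j0 = Max J"
  have J: "finite J" "0 \<in> J" by (auto simp: J_def)
  then have "j0 \<in> J" unfolding j0_def by (intro Max_in) auto
  then have j0: "j0 \<le> \<nu>" and j0_dvd: "\<And>i. i < N \<Longrightarrow> p ^ j0 dvd Poly_Mapping.lookup e (int i)"
    by (auto simp: J_def)
  \<comment> \<open>The exponent of \<open>T\<^sub>0\<close> is \<open>n - h\<close>, and \<open>p ^ \<nu>\<close> divides \<open>n\<close>.\<close>
  have "p ^ j0 dvd n" using p(2) j0 by (meson dvd_trans le_imp_power_dvd)
  moreover have "p ^ j0 dvd n - h" using j0_dvd[of 0] N h(2) by simp
  ultimately have "p ^ j0 dvd h" using h(1)
    by (metis atLeastAtMost_iff diff_diff_cancel dvd_diff_nat)
  then have j0_le: "j0 \<le> vp_bar p \<nu> (int h)" using p(1) h(1) j0 by (intro vp_bar_geI) auto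
  define K where "K = {v \<in> Poly_Mapping.keys e. v < 0}"
  define cv where "cv v = c v ^ Poly_Mapping.lookup e v" for v
  have vC: "vL (c (- int h')) = ereal (real n) * vK (poly.coeff f (n - h')) - ereal (real h')"
    "0 \<le> vL (c (- int h'))" if "0 < h'" "h' \<le> n" for h'
  proof -
    have "vL (c (- int h')) = vL (\<iota> (- poly.coeff f (n - h'))) + vL (inverse (\<tau> ^ h'))"
      unfolding cC[OF that] divide_inverse L.v_mult ..
    also have "vL (inverse (\<tau> ^ h')) = - ereal (real h')"
      using \<tau>0 \<tau> by (simp add: L.v_inverse L.v_power uniformizer_def one_ereal_def)
    also have "vL (\<iota> (- poly.coeff f (n - h'))) = ereal (real n) * vK (poly.coeff f (n - h'))"
      by (simp only: ramified K.v_minus)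
    finally show eq: "vL (c (- int h')) = ereal (real n) * vK (poly.coeff f (n - h')) - ereal (real h')"
      by (simp add: minus_ereal_def)
    have "ereal (real n) \<le> ereal (real n) * vK (poly.coeff f (n - h')) + ereal (real (n - h'))"
      using that by (intro min_poly_coeff_val[OF \<tau> f]) auto
    then show "0 \<le> vL (c (- int h'))" unfolding eq using that
      by (cases "vK (poly.coeff f (n - h'))") (auto simp: of_nat_diff n_pos)
  qed
  have c_pos: "0 \<le> vL (c v)" if "v \<in> Poly_Mapping.keys e" for v
  proof (cases "0 \<le> v")
    case False
    then show ?thesis using vC(2)[of "nat (- v)"] range(1)[OF that] by simp
  qed (rule c_nonneg)
  \<comment> \<open>Choose \<open>C\<^bsub>h'\<^esub>\<close> with the least \<open>vp_bar\<close> among those occurring; if none occurs, \<open>h' = n\<close> and \<open>t = \<nu>\<close> will do.\<close>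
  have "\<exists>t h'. t \<le> \<nu> \<and> h' \<in> {1..n} \<and> vp_bar p \<nu> (int h') \<le> t \<and> (\<forall>v\<in>K. int (p ^ t) dvd v) \<and>
      ereal (real n) * vK (poly.coeff f (n - h')) - ereal (real h') \<le> vL (prod cv K)"
  proof (cases "K = {}")
    case True
    have "ereal (real n) * vK (poly.coeff f 0) - ereal (real n) \<le> 0"
      using min_poly_coeff_0_val[OF \<tau> f] n_pos by (cases "vK (poly.coeff f 0)") auto
    then show ?thesis using True n_pos
      by (intro exI[of _ \<nu>] exI[of _ n]) (auto simp: vp_bar_pos)
  next
    case False
    moreover have "finite K" by (simp add: K_def)
    ultimately obtain v1 where v1: "v1 \<in> K" and min: "\<And>v. v \<in> K \<Longrightarrow> vp_bar p \<nu> (- v1) \<le> vp_bar p \<nu> (- v)"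
      using ex_min_if_finite[of "(\<lambda>v. vp_bar p \<nu> (- v)) ` K"] by (auto simp: not_less)
    define h' where "h' = nat (- v1)"
    have v1_eq: "v1 = - int h'" and h': "0 < h'" "h' \<le> n"
      using v1 range(1)[of v1] by (auto simp: K_def h'_def)
    let ?t = "vp_bar p \<nu> (int h')"
    have "int (p ^ ?t) dvd v" if v: "v \<in> K" for v
    proof -
      have "?t \<le> vp_bar p \<nu> (int (nat (- v)))" using min[OF v] v v1_eq by (simp add: K_def)
      then have "int (p ^ ?t) dvd int (nat (- v))"
        using v by (intro power_dvd_of_le_vp_bar) (auto simp: K_def)
      then show ?thesis using v by (simp add: K_def)
    qed
    moreover have "vL (c v1) \<le> vL (prod cv K)"
    proof -
      have "vL (c v1) \<le> vL (cv v1)" unfolding cv_def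
        using v1 c_pos by (intro L.v_power_ge) (auto simp: K_def in_keys_iff)
      also have "\<dots> \<le> vL (prod cv K)"
        using v1 c_pos by (intro L.v_prod_ge) (auto simp: K_def cv_def intro!: L.v_power_nonneg)
      finally show ?thesis .
    qed
    ultimately show ?thesis using h' vC(1)[OF h'] v1_eq
      by (intro exI[of _ ?t] exI[of _ h']) (auto simp: vp_bar_pos)
  qed
  then obtain t h' where t: "t \<le> \<nu>" and h': "h' \<in> {1..n}" "vp_bar p \<nu> (int h') \<le> t"
    and dvd_K: "\<And>v. v \<in> K \<Longrightarrow> int (p ^ t) dvd v"
    and vK_le: "ereal (real n) * vK (poly.coeff f (n - h')) - ereal (real h') \<le> vL (prod cv K)"
    by blast
  \<comment> \<open>By maximality of \<open>j0\<close>, some \<open>T\<close>-exponent is not divisible by \<open>p ^ Suc j0\<close> when \<open>t > j0\<close>.\<close>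
  have "int p ^ (t - j0) dvd Poly_Mapping.lookup ?G e"
  proof (cases "t \<le> j0")
    case False
    then have "Suc j0 \<notin> J" using J Max_ge[of J "Suc j0"] unfolding j0_def by fastforce
    then obtain i where i: "i < N" "\<not> p ^ Suc j0 dvd Poly_Mapping.lookup e (int i)"
      using False t by (auto simp: J_def)
    have "p ^ t dvd n" using p(2) t by (meson dvd_trans le_imp_power_dvd)
    then have "int (p ^ t) dvd int (Poly_Mapping.lookup e (int i)) * Poly_Mapping.lookup ?G e"
      using N m0 dvd_K i(1) by (intro generic_norm_dvd) (auto simp: K_def)
    then have "int p ^ t dvd int (Poly_Mapping.lookup e (int i)) * Poly_Mapping.lookup ?G e" by simp
    moreover have "\<not> int p ^ Suc j0 dvd int (Poly_Mapping.lookup e (int i))"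
      using i(2) by (metis int_dvd_int_iff of_nat_power)
    ultimately show ?thesis
      using prime_elem_power_dvd_cases[of "int p" t _ _ "Suc j0" "t - j0"] False p(1) by auto
  qed simp
  then have v_coeff: "ereal (real (t - j0)) * vL (of_nat p) \<le> vL (of_int (Poly_Mapping.lookup ?G e))"
    by (rule L.v_of_int_dvd)
  have "?I j0 \<le> ereal (real n) * vK (poly.coeff f (n - h')) - ereal (real h')
      + ereal (real (max t j0 - j0)) * vL (of_nat p)"
    using insep_index_le[of h' p \<nu> "max t j0" j0 \<tau>] h' t j0 unfolding mp by auto
  also have "max t j0 - j0 = t - j0" by simp
  also have "ereal (real n) * vK (poly.coeff f (n - h')) - ereal (real h') + ereal (real (t - j0)) * vL (of_nat p)
      \<le> vL (prod cv K) + vL (of_int (Poly_Mapping.lookup ?G e))"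
    using vK_le v_coeff by (rule add_mono)
  finally have I_le: "?I j0 \<le> vL (prod cv K) + vL (of_int (Poly_Mapping.lookup ?G e))" .
  have "ereal (real p ^ j0 * real l) \<le> vL (cv v0)"
  proof -
    have "v0 < int N" by (rule range(2)[OF v0(1)])
    then have "p ^ j0 dvd Poly_Mapping.lookup e v0" using j0_dvd[of "nat v0"] v0(2) by simp
    moreover have "Poly_Mapping.lookup e v0 > 0" using v0(1) by (simp add: in_keys_iff)
    ultimately have "p ^ j0 \<le> Poly_Mapping.lookup e v0" by (rule dvd_imp_le)
    then have le: "real p ^ j0 \<le> real (Poly_Mapping.lookup e v0)" by (metis of_nat_le_iff of_nat_power)
    show ?thesis unfolding cv_def L.v_power
    proof (cases "vL (c v0)")
      case (real r)
      then have "real p ^ j0 * real l \<le> real (Poly_Mapping.lookup e v0) * r"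
        using v0(3) le by (intro mult_mono) auto
      then show "ereal (real p ^ j0 * real l) \<le> ereal (real (Poly_Mapping.lookup e v0)) * vL (c v0)"
        using real by simp
    qed (use v0(1,3) in \<open>auto simp: in_keys_iff\<close>)
  qed
  also have "vL (cv v0) \<le> vL (prod cv (Poly_Mapping.keys e - K))"
    using v0 c_pos by (intro L.v_prod_ge) (auto simp: K_def cv_def intro!: L.v_power_nonneg)
  finally have S_le: "ereal (real p ^ j0 * real l) \<le> vL (prod cv (Poly_Mapping.keys e - K))" .
  have "ereal (hasse_herbrand \<iota> vK vL p \<nu> \<tau> (vp_bar p \<nu> (int h)) (real l)) \<le> ?I j0 + ereal (real p ^ j0 * real l)"
    using j0_le h(1) by (intro hasse_herbrand_le[OF \<tau>]) (auto simp: vp_bar_pos)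
  also have "\<dots> \<le> (vL (prod cv K) + vL (of_int (Poly_Mapping.lookup ?G e))) + vL (prod cv (Poly_Mapping.keys e - K))"
    using I_le S_le by (rule add_mono)
  also have "\<dots> = vL (of_int (Poly_Mapping.lookup ?G e) * (prod cv (Poly_Mapping.keys e - K) * prod cv K))"
    by (simp add: L.v_mult ac_simps)
  also have "prod cv (Poly_Mapping.keys e - K) * prod cv K = monom_val c e"
    unfolding monom_val_def cv_def[symmetric]
    by (rule prod.subset_diff[symmetric]) (auto simp: K_def)
  finally show ?thesis .
qed


end

section \<open>Minimal polynomials of congruent uniformizers\<close>

context totally_ramified_extension
begin

text \<open>The data describing a sum of two elements \<open>\<Sum> b\<^sub>m \<tau>\<^sup>m\<close> and \<open>\<Sum> d\<^sub>m \<tau>\<^sup>m\<close>: of the \<open>2n + 1\<close> variables \<open>T\<^sub>i\<close>,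
the first is the indeterminate of the characteristic polynomial, the next \<open>n\<close> carry the terms of the
first element and the last \<open>n\<close> those of the second. The exponent of \<open>\<tau>\<close> in the \<open>i\<close>-th term is \<open>split_exps i\<close>.\<close>

definition split_exps :: "nat \<Rightarrow> nat"
  where "split_exps i = (if i = 0 then 0 else (i - 1) mod n)"

text \<open>The coefficients of the terms in the same numbering, with \<open>0\<close> for \<open>T\<^sub>0\<close>.\<close>

definition split_coeffs :: "(nat \<Rightarrow> 'k) \<Rightarrow> (nat \<Rightarrow> 'k) \<Rightarrow> nat \<Rightarrow> 'k"
  where "split_coeffs b d i = (if i = 0 then 0 else if i \<le> n then b (i - 1) else d (i - n - 1))"

text \<open>The point at which the generic norm is evaluated: the terms of both elements divided by \<open>-\<tau>\<close>, and
the coefficients \<open>-f\<^bsub>n-h\<^esub> \<tau>\<^sup>-\<^sup>h\<close> for \<open>C\<^sub>h\<close>, where \<open>f\<close> is the minimal polynomial of \<open>\<tau>\<close>.\<close>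

definition split_point :: "'l \<Rightarrow> 'k poly \<Rightarrow> (nat \<Rightarrow> 'k) \<Rightarrow> (nat \<Rightarrow> 'k) \<Rightarrow> int \<Rightarrow> 'l"
  where "split_point \<tau> f b d v =
    (if v = 0 then 1
     else if 0 < v \<and> v \<le> 2 * int n then
       - (\<iota> (split_coeffs b d (nat v)) * \<tau> ^ split_exps (nat v) / \<tau>)
     else if - int n \<le> v \<and> v < 0 then
       \<iota> (- poly.coeff f (n - nat (- v))) / \<tau> ^ nat (- v)
     else 0)"

lemma min_poly_coeff_eq:
  assumes \<tau>: "uniformizer vL \<tau>" and f: "is_min_poly \<iota> \<tau> f"
    and y: "uniformizer vL ((\<Sum>m<n. \<iota> (b m) * \<tau> ^ m) + (\<Sum>m<n. \<iota> (d m) * \<tau> ^ m))"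
      "is_min_poly \<iota> ((\<Sum>m<n. \<iota> (b m) * \<tau> ^ m) + (\<Sum>m<n. \<iota> (d m) * \<tau> ^ m)) g"
    and k: "k \<le> n"
  shows "\<iota> (poly.coeff g k) = \<tau> ^ (n - k) *
    (\<Sum>e | e \<in> Poly_Mapping.keys (generic_norm n (2 * n + 1) split_exps) \<and> Poly_Mapping.lookup e 0 = k.
      of_int (Poly_Mapping.lookup (generic_norm n (2 * n + 1) split_exps) e) * monom_val (split_point \<tau> f b d) e)"
proof -
  let ?y = "(\<Sum>m<n. \<iota> (b m) * \<tau> ^ m) + (\<Sum>m<n. \<iota> (d m) * \<tau> ^ m)"
  let ?N = "2 * n + 1" and ?a = "\<lambda>j. - poly.coeff f j"
  have \<tau>0: "\<tau> \<noteq> 0" using \<tau> by (auto simp: uniformizer_def one_ereal_def)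
  define P where "P = char_poly (power_comb n ?N split_exps (split_coeffs b d) ?a)"
  have mapP: "map_poly \<iota> P = char_poly (power_comb n ?N split_exps (\<lambda>i. \<iota> (split_coeffs b d i)) (\<lambda>j. \<iota> (?a j)))"
    unfolding P_def char_poly_hom[OF power_comb_carrier, symmetric] map_power_comb ..
  have "(\<Sum>i<?N. \<iota> (split_coeffs b d i) * \<tau> ^ split_exps i) =
      (\<Sum>i<n + n. \<iota> (split_coeffs b d (Suc i)) * \<tau> ^ split_exps (Suc i))"
    by (simp add: sum.lessThan_Suc_shift split_coeffs_def mult_2 del: sum.lessThan_Suc)
  also have "\<dots> = ?y"
    unfolding sum_lessThan_add
    by (intro arg_cong2[of _ _ _ _ "(+)"] sum.cong) (auto simp: split_coeffs_def split_exps_def)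
  finally have "poly (map_poly \<iota> P) ?y = 0"
    unfolding mapP using power_comb_char_poly_root[OF min_poly_relation[OF \<tau> f] n_pos] by metis
  moreover have "Polynomial.degree P = n" "poly.coeff P n = 1"
    using degree_monic_char_poly[OF power_comb_carrier] unfolding P_def by blast+
  ultimately have "is_min_poly \<iota> ?y P"
    using y(1) by (intro uniformizer_min_polyI) simp_all
  then have "g = P" by (rule is_min_poly_unique[OF field_hom_axioms y(2)])
  then have "\<iota> (poly.coeff g k) = poly.coeff (map_poly \<iota> P) k" by simp
  also have "\<dots> = \<tau> ^ (n - k) *
    (\<Sum>e | e \<in> Poly_Mapping.keys (generic_norm n ?N split_exps) \<and> Poly_Mapping.lookup e 0 = k.
      of_int (Poly_Mapping.lookup (generic_norm n ?N split_exps) e) * monom_val (split_point \<tau> f b d) e)"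
    unfolding mapP using \<tau>0 k
    by (intro coeff_char_poly_power_comb) (auto simp: split_exps_def split_coeffs_def split_point_def)
  finally show ?thesis .
qed

lemma split_point_nonneg:
  assumes \<tau>: "uniformizer vL \<tau>"
    and b: "1 \<le> vL (\<Sum>m<n. \<iota> (b m) * \<tau> ^ m)"
    and d: "ereal (real l + 1) \<le> vL (\<Sum>m<n. \<iota> (d m) * \<tau> ^ m)"
  shows "0 \<le> v \<Longrightarrow> 0 \<le> vL (split_point \<tau> f b d v)"
    and "int n < v \<Longrightarrow> ereal (real l) \<le> vL (split_point \<tau> f b d v)"
proof -
  have \<tau>0: "\<tau> \<noteq> 0" using \<tau> by (auto simp: uniformizer_def one_ereal_def)
  have div: "ereal r \<le> vL (x / \<tau>)" if "ereal (r + 1) \<le> vL x" for x r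
  proof -
    have "vL x = vL (x / \<tau>) + 1"
      using L.v_mult[of "x / \<tau>" \<tau>] \<tau> \<tau>0 by (simp add: uniformizer_def)
    then show ?thesis using that by (cases "vL (x / \<tau>)") (auto simp: one_ereal_def)
  qed
  have S: "ereal (real l) \<le> vL (split_point \<tau> f b d v)" if v: "int n < v" "v \<le> 2 * int n" for v
  proof -
    define i where "i = nat v - n - 1"
    have i: "i < n" "nat v = Suc (n + i)" using v by (auto simp: i_def)
    have eq: "split_point \<tau> f b d v = - (\<iota> (d i) * \<tau> ^ i / \<tau>)"
      using v i by (simp add: split_point_def split_coeffs_def split_exps_def)
    have "ereal (real l + 1) \<le> vL (\<iota> (d i) * \<tau> ^ i)"
      using d vL_expansion[OF \<tau> i(1), of d] by (rule order_trans)
    then show ?thesis unfolding eq L.v_minus by (rule div)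
  qed
  have T: "0 \<le> vL (split_point \<tau> f b d v)" if v: "0 < v" "v \<le> int n" for v
  proof -
    define i where "i = nat v - 1"
    have i: "i < n" "nat v = Suc i" using v by (auto simp: i_def)
    have eq: "split_point \<tau> f b d v = - (\<iota> (b i) * \<tau> ^ i / \<tau>)"
      using v i by (simp add: split_point_def split_coeffs_def split_exps_def)
    have "1 \<le> vL (\<iota> (b i) * \<tau> ^ i)"
      using b vL_expansion[OF \<tau> i(1), of b] by (rule order_trans)
    then have "ereal 0 \<le> vL (\<iota> (b i) * \<tau> ^ i / \<tau>)" by (intro div) (simp add: one_ereal_def)
    then show ?thesis unfolding eq L.v_minus by (simp add: zero_ereal_def)
  qed
  have out: "split_point \<tau> f b d v = 0" if "2 * int n < v" for v
    using that by (simp add: split_point_def)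
  show "ereal (real l) \<le> vL (split_point \<tau> f b d v)" if "int n < v"
    using S[OF that] out[of v] by (cases "v \<le> 2 * int n") auto
  show "0 \<le> vL (split_point \<tau> f b d v)" if "0 \<le> v"
  proof -
    have "v = 0 \<or> 0 < v \<and> v \<le> int n \<or> int n < v \<and> v \<le> 2 * int n \<or> 2 * int n < v"
      using that by arith
    then consider "v = 0" | "0 < v" "v \<le> int n" | "int n < v" "v \<le> 2 * int n" | "2 * int n < v"
      by blast
    then show ?thesis
    proof cases
      case 3
      have "0 \<le> ereal (real l)" by simp
      also note S[OF 3]
      finally show ?thesis .
    qed (use T out in \<open>auto simp: split_point_def\<close>)
  qed
qed

text \<open>The coefficients of \<open>g\<close> and \<open>f\<close> are values of the same generic norm, for the sums \<open>x + (y - x)\<close> and \<open>x + 0\<close>.\<close>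

lemma uniformizer_congruent_coeffs:
  assumes p: "prime p" "p ^ \<nu> dvd n"
    and x: "uniformizer vL x" "is_min_poly \<iota> x f" and y: "uniformizer vL y" "is_min_poly \<iota> y g"
    and xy: "ereal (real l + 1) \<le> vL (y - x)" and \<tau>: "uniformizer vL \<tau>" and h: "h \<in> {1..n}"
  shows "ereal (hasse_herbrand \<iota> vK vL p \<nu> \<tau> (vp_bar p \<nu> (int h)) (real l) + real h) \<le>
    ereal (real n) * vK (poly.coeff g (n - h) - poly.coeff f (n - h))"
proof -
  let ?G = "generic_norm n (2 * n + 1) split_exps"
  let ?\<phi> = "hasse_herbrand \<iota> vK vL p \<nu> \<tau> (vp_bar p \<nu> (int h)) (real l)"
  obtain F where F: "is_min_poly \<iota> \<tau> F" using uniformizer_min_poly_exists[OF \<tau>] by blast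
  obtain b where b: "x = (\<Sum>m<n. \<iota> (b m) * \<tau> ^ m)" using expansion_exists[OF \<tau>] by blast
  obtain d where d: "y - x = (\<Sum>m<n. \<iota> (d m) * \<tau> ^ m)" using expansion_exists[OF \<tau>] by blast
  define c where "c = split_point \<tau> F b d"
  define c0 where "c0 = split_point \<tau> F b (\<lambda>_. 0)"
  define E where "E = {e \<in> Poly_Mapping.keys ?G. Poly_Mapping.lookup e 0 = n - h}"
  have y_eq: "y = (\<Sum>m<n. \<iota> (b m) * \<tau> ^ m) + (\<Sum>m<n. \<iota> (d m) * \<tau> ^ m)"
    unfolding b[symmetric] d[symmetric] by simp
  have x_eq: "x = (\<Sum>m<n. \<iota> (b m) * \<tau> ^ m) + (\<Sum>m<n. \<iota> ((\<lambda>_. 0) m) * \<tau> ^ m)"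
    using b by simp
  have nh: "n - (n - h) = h" using h by simp
  have cg: "\<iota> (poly.coeff g (n - h)) = \<tau> ^ h * (\<Sum>e\<in>E. of_int (Poly_Mapping.lookup ?G e) * monom_val c e)"
    using min_poly_coeff_eq[OF \<tau> F y[unfolded y_eq], of "n - h"] unfolding nh E_def c_def by simp
  have cf: "\<iota> (poly.coeff f (n - h)) = \<tau> ^ h * (\<Sum>e\<in>E. of_int (Poly_Mapping.lookup ?G e) * monom_val c0 e)"
    using min_poly_coeff_eq[OF \<tau> F x[unfolded x_eq], of "n - h"] unfolding nh E_def c0_def by simp
  have diff: "\<iota> (poly.coeff g (n - h) - poly.coeff f (n - h)) =
      \<tau> ^ h * (\<Sum>e\<in>E. of_int (Poly_Mapping.lookup ?G e) * (monom_val c e - monom_val c0 e))"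
    unfolding hom_minus cg cf by (simp add: right_diff_distrib sum_subtractf)
  \<comment> \<open>A monomial without the last \<open>n\<close> variables \<open>T\<^sub>i\<close> has the same value at both points.\<close>
  have bound: "ereal ?\<phi> \<le> vL (of_int (Poly_Mapping.lookup ?G e) * (monom_val c e - monom_val c0 e))"
    if e: "e \<in> E" for e
  proof (cases "\<exists>v\<in>Poly_Mapping.keys e. int n < v")
    case False
    have "monom_val c e = monom_val c0 e"
    proof (rule monom_val_cong)
      fix v assume "v \<in> Poly_Mapping.keys e"
      then have "v \<le> int n" using False by force
      then show "c v = c0 v"
        by (auto simp: c_def c0_def split_point_def split_coeffs_def)
    qed
    then show ?thesis by simp
  next
    case True
    then obtain v0 where v0: "v0 \<in> Poly_Mapping.keys e" "int n < v0" by blast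
    have "c0 v0 = 0" using v0(2)
      by (auto simp: c0_def split_point_def split_coeffs_def)
    then have "monom_val c0 e = 0" by (rule monom_val_eq_0[OF v0(1)])
    moreover have "ereal ?\<phi> \<le> vL (of_int (Poly_Mapping.lookup ?G e) * monom_val c e)"
    proof (rule monomial_bound[OF p _ _ \<tau> F])
      have "1 \<le> vL (\<Sum>m<n. \<iota> (b m) * \<tau> ^ m)" using x(1) b by (simp add: uniformizer_def)
      note nonneg = split_point_nonneg[OF \<tau> this xy[unfolded d]]
      show "ereal (real l) \<le> vL (c v0)" unfolding c_def by (rule nonneg(2)[OF v0(2)])
      show "0 \<le> vL (c v)" if "0 \<le> v" for v unfolding c_def by (rule nonneg(1)[OF that])
      show "Poly_Mapping.lookup e 0 = n - h" using e by (simp add: E_def)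
      show "c (- int k) = \<iota> (- poly.coeff F (n - k)) / \<tau> ^ k" if "0 < k" "k \<le> n" for k
        using that by (simp add: c_def split_point_def)
      show "c v = 0" if "v < - int n \<or> int (2 * n + 1) \<le> v" for v
        using that by (auto simp: c_def split_point_def)
    qed (use v0 h in \<open>auto simp: split_exps_def\<close>)
    ultimately show ?thesis by simp
  qed
  have "ereal ?\<phi> + ereal (real h) \<le> vL (\<Sum>e\<in>E. of_int (Poly_Mapping.lookup ?G e) * (monom_val c e - monom_val c0 e)) + ereal (real h)"
    by (intro add_right_mono L.v_sum_ge bound)
  also have "\<dots> = vL (\<iota> (poly.coeff g (n - h) - poly.coeff f (n - h)))"
    using \<tau> unfolding diff by (simp add: L.v_mult L.v_power uniformizer_def one_ereal_def add.commute)
  finally show ?thesis unfolding ramified by simp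
qed

end

theorem theorem4p3:
  fixes vK :: "'k::field \<Rightarrow> ereal" and vL :: "'l::field \<Rightarrow> ereal"
    and \<iota> :: "'k \<Rightarrow> 'l" and p n u \<nu> l :: nat
    and \<pi> \<pi>' \<tau> :: 'l and \<sigma> :: "'l \<Rightarrow> 'l" and f f' :: "'k poly"
  assumes "complete_discretely_valued_field vK"
    and "perfect_of_characteristic (residue_field vK) p"
    and "field_hom \<iota>"
    and "ext_degree \<iota> = n" and "n = u * p ^ \<nu>" and "\<not> p dvd u"
    and "separable_extension \<iota>"
    and "normalized_discrete_valuation vL" and "totally_ramified \<iota> vK vL"
    and "uniformizer vL \<pi>" and "is_min_poly \<iota> \<pi> f"
    and "uniformizer vL \<pi>'" and "is_min_poly \<iota> \<pi>' f'"
    and "l \<ge> 1" and "is_automorphism_over \<iota> \<sigma>"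
    and "cong_mod (\<sigma> \<pi>') \<pi> (max_ideal_power vL (l + 1))"
    and "uniformizer vL \<tau>"  (* auxiliary: used to compute the indices of inseparability of L/K *)
  shows "\<forall>h\<in>{1..n}. cong_mod (signed_coeff n f' h) (signed_coeff n f h)
           (max_ideal_power vK (nat (rho \<iota> vK vL p \<nu> \<tau> h l)))"
proof
  fix h assume h: "h \<in> {1..n}"
  have prime: "prime p" using assms(2) by (simp add: perfect_of_characteristic_def)
  have n_pos: "n > 0" using h by simp
  interpret K: complete_discretely_valued_field vK by fact
  interpret L: normalized_discrete_valuation vL by fact
  interpret totally_ramified_extension \<iota> vK vL n
    using assms n_pos
    by (intro totally_ramified_extension.intro totally_ramified_extension_axioms.intro
        K.normalized_discrete_valuation_axioms) (auto simp: totally_ramified_def)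
  interpret \<sigma>: field_hom \<sigma> using assms(15) by (simp add: is_automorphism_over_def)
  have \<sigma>\<iota>: "\<sigma> (\<iota> a) = \<iota> a" for a using assms(15) by (simp add: is_automorphism_over_def)
  have close: "ereal (real l + 1) \<le> vL (\<sigma> \<pi>' - \<pi>)"
    using assms(16) unfolding cong_mod_def L.max_ideal_power_eq by (simp add: add.commute)
  have "1 < ereal (real l + 1)" using assms(14) by (simp add: one_ereal_def)
  then have gt: "1 < vL (\<sigma> \<pi>' - \<pi>)" using close by (rule less_le_trans)
  have unif: "uniformizer vL (\<sigma> \<pi>')"
    unfolding uniformizer_def
  proof (rule antisym)
    have "\<pi> = \<sigma> \<pi>' - (\<sigma> \<pi>' - \<pi>)" by simp
    then have "min (vL (\<sigma> \<pi>')) (vL (\<sigma> \<pi>' - \<pi>)) \<le> vL \<pi>"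
      using L.v_add[of "\<sigma> \<pi>'" "- (\<sigma> \<pi>' - \<pi>)"] unfolding L.v_minus by simp
    then show "vL (\<sigma> \<pi>') \<le> 1"
      using gt assms(10) by (auto simp: uniformizer_def min_def split: if_splits)
    show "1 \<le> vL (\<sigma> \<pi>')"
      using L.v_add_ge[of 1 \<pi> "\<sigma> \<pi>' - \<pi>"] gt assms(10) by (simp add: uniformizer_def)
  qed
  have "poly (map_poly \<iota> f') (\<sigma> \<pi>') = \<sigma> (poly (map_poly \<iota> f') \<pi>')"
    by (simp add: poly_altdef \<sigma>.hom_sum \<sigma>.hom_mult \<sigma>.hom_power \<sigma>\<iota>)
  then have f': "is_min_poly \<iota> (\<sigma> \<pi>') f'"
    using unif assms(13) uniformizer_min_poly_degree[OF assms(12,13)]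
    by (intro uniformizer_min_polyI) (auto simp: is_min_poly_def)
  let ?j = "vp_bar p \<nu> (int h)"
  let ?\<phi> = "hasse_herbrand \<iota> vK vL p \<nu> \<tau> ?j (real l)"
  let ?x = "poly.coeff f' (n - h) - poly.coeff f (n - h)"
  have bound: "ereal (?\<phi> + real h) \<le> ereal (real n) * vK ?x"
    using assms(5) by (intro uniformizer_congruent_coeffs[OF prime _ assms(10,11) unif f' close assms(17) h]) simp
  have \<phi>: "0 \<le> ?\<phi>"
    using h by (intro hasse_herbrand_nonneg[OF assms(17)]) (auto simp: vp_bar_pos)
  have "ereal (real (nat (rho \<iota> vK vL p \<nu> \<tau> h l))) \<le> vK ?x"
  proof (cases "?x = 0")
    case False
    then obtain k where k: "vK ?x = ereal (of_int k)" by (rule K.v_finite)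
    then have "?\<phi> + real h \<le> real n * of_int k" using bound by simp
    then have "(?\<phi> + real h) / real n \<le> of_int k"
      using n_pos by (simp add: divide_le_eq mult.commute)
    moreover have "0 \<le> (?\<phi> + real h) / real n" using \<phi> by simp
    ultimately have "rho \<iota> vK vL p \<nu> \<tau> h l \<le> k" "0 \<le> k"
      unfolding rho_def Let_def degree_eq by (simp_all add: ceiling_le_iff)
    then have "real (nat (rho \<iota> vK vL p \<nu> \<tau> h l)) \<le> of_int k" by linarith
    then show ?thesis using k by simp
  qed simp
  moreover have "signed_coeff n f' h - signed_coeff n f h = (- 1) ^ h * ?x"
    by (simp add: signed_coeff_def right_diff_distrib)
  ultimately show "cong_mod (signed_coeff n f' h) (signed_coeff n f h)
      (max_ideal_power vK (nat (rho \<iota> vK vL p \<nu> \<tau> h l)))"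
    unfolding cong_mod_def K.max_ideal_power_eq by simp
qed

end
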